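(* The golden L translation surface has unbounded bunching. That is, for every positive integer $K$ there exists a ball $B$ of radius $1$ in $\mathbb{R}^2$ that contains at least $K$ (distinct) vectors that are periods of saddle connections on the golden L.
   Context: A translation surface is a pair $(X,\omega)$, where $X$ is a compact Riemann surface and $\omega$ is a holomorphic $1$-form on $X$. Equivalently, it is given by a finite collection of disjoint polygons in the plane, with each edge paired with a parallel edge of the same length, such that paired edges lie on opposite sides of the polygons they bound; paired edges are glued by translation, and $\omega$ is induced by $dz$ on the plane. A saddle connection on $(X,\omega)$ is a geodesic segment (for the flat metric $|\omega|$) that starts and ends at a zero of $\omega$, with no zeros in the interior of the segment. The period of a saddle connection is the complex number obtained by integrating $\omega$ over it, regarded as a vector in $\mathbb{R}^2\cong\mathbb{C}$; it records the length and direction of the saddle connection. A translation surface $(X,\omega)$ has unbounded bunching if for every positive integer $K$ there exists a ball $B$ of radius $1$ in $\mathbb{R}^2$ that contains at least $K$ vectors that are periods of saddle connections on $(X,\omega)$. Let $\phi=\frac{1+\sqrt5}{2}$ be the golden ratio. The golden L is the translation surface obtained from the L-shaped polygon $([0,\phi]\times[0,1])\cup([0,1]\times[0,\phi])$ in $\mathbb{R}^2$ by gluing, by translations, the following pairs of edges: $[0,1]\times\{0\}$ with $[0,1]\times\{\phi\}$; $[1,\phi]\times\{0\}$ with $[1,\phi]\times\{1\}$; $\{0\}\times[0,1]$ with $\{\phi\}\times[0,1]$; $\{0\}\times[1,\phi]$ with $\{1\}\times[1,\phi]$. The resulting $1$-form has a single zero, of order $2$, which is the image of the endpoints of these edges.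 *)

theory Defs
  imports "HOL-Complex_Analysis.Complex_Analysis"
begin

section \<open>Surfaces with a holomorphic 1-form\<close>

text \<open>
  A surface \<open>X\<close> with a holomorphic 1-form \<open>\<omega>\<close>: the topology of \<open>X\<close> and an atlas of triples
  \<open>(U, \<phi>, f)\<close>, where \<open>\<phi>\<close> is a local complex coordinate with domain \<open>U\<close> (its values outside \<open>U\<close>
  are irrelevant) and \<open>\<omega> = f(w) dw\<close> on \<open>U\<close> in the coordinate \<open>w = \<phi>\<close>.
\<close>

record 'a form_surface =
  surface :: "'a topology"
  form_charts :: "('a set \<times> ('a \<Rightarrow> complex) \<times> (complex \<Rightarrow> complex)) set"

text \<open>
  Coefficients of \<open>\<omega>\<close> in two coordinates at the same point differ by a nonzero factor, so
  vanishing in every coordinate at \<open>x\<close> is the same as vanishing in one of them.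
\<close>

definition zero_of_form :: "('a, 'z) form_surface_scheme \<Rightarrow> 'a \<Rightarrow> bool" where
  "zero_of_form S x \<longleftrightarrow> x \<in> topspace (surface S) \<and>
     (\<forall>(U, \<phi>, f) \<in> form_charts S. x \<in> U \<longrightarrow> f (\<phi> x) = 0)"

text \<open>The relation \<open>\<omega>(\<gamma>'(t)) = v\<close>.\<close>

definition form_along ::
  "('a, 'z) form_surface_scheme \<Rightarrow> (real \<Rightarrow> 'a) \<Rightarrow> real \<Rightarrow> complex \<Rightarrow> bool" where
  "form_along S \<gamma> t v \<longleftrightarrow> (\<exists>(U, \<phi>, f) \<in> form_charts S. \<gamma> t \<in> U \<and>
     (\<exists>D. ((\<lambda>s. \<phi> (\<gamma> s)) has_vector_derivative D) (at t) \<and> f (\<phi> (\<gamma> t)) * D = v))"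

text \<open>The relation \<open>\<integral>\<^sub>\<gamma> \<omega> = v\<close> for a path \<open>\<gamma>\<close> parametrized by \<open>[0,1]\<close>.\<close>

definition has_period ::
  "('a, 'z) form_surface_scheme \<Rightarrow> (real \<Rightarrow> 'a) \<Rightarrow> complex \<Rightarrow> bool" where
  "has_period S \<gamma> v \<longleftrightarrow>
     (\<exists>g. (\<forall>t\<in>{0<..<1}. form_along S \<gamma> t (g t)) \<and> (g has_integral v) {0..1})"

text \<open>
  Away from the zeros, local primitives of \<open>\<omega>\<close> are coordinates in which the metric \<open>|\<omega>|\<close> is
  Euclidean. Geodesics of constant speed are therefore the paths that are affine in these
  coordinates, that is, the paths for which \<open>\<omega>(\<gamma>'(t))\<close> is constant.
\<close>

definition saddle_connection :: "('a, 'z) form_surface_scheme \<Rightarrow> (real \<Rightarrow> 'a) \<Rightarrow> bool" where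
  "saddle_connection S \<gamma> \<longleftrightarrow>
     pathin (surface S) \<gamma> \<and>
     zero_of_form S (\<gamma> 0) \<and> zero_of_form S (\<gamma> 1) \<and>
     (\<forall>t\<in>{0<..<1}. \<not> zero_of_form S (\<gamma> t)) \<and>
     (\<exists>v. v \<noteq> 0 \<and> (\<forall>t\<in>{0<..<1}. form_along S \<gamma> t v))"

definition saddle_periods :: "('a, 'z) form_surface_scheme \<Rightarrow> complex set" where
  "saddle_periods S = {v. \<exists>\<gamma>. saddle_connection S \<gamma> \<and> has_period S \<gamma> v}"

definition unbounded_bunching :: "('a, 'z) form_surface_scheme \<Rightarrow> bool" where
  "unbounded_bunching S \<longleftrightarrow>
     (\<forall>K::nat. 1 \<le> K \<longrightarrow>
       (\<exists>c. \<exists>A. A \<subseteq> saddle_periods S \<inter> ball c 1 \<and> finite A \<and> K \<le> card A))"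


section \<open>Gluing polygons by translations\<close>

definition quotient_topology :: "'a topology \<Rightarrow> ('a \<Rightarrow> 'b) \<Rightarrow> 'b topology" where
  "quotient_topology T p =
     topology (\<lambda>V. V \<subseteq> p ` topspace T \<and> openin T {x \<in> topspace T. p x \<in> V})"

lemma openin_quotient_topology:
  "openin (quotient_topology T p) V \<longleftrightarrow>
     V \<subseteq> p ` topspace T \<and> openin T {x \<in> topspace T. p x \<in> V}"
proof -
  have "istopology (\<lambda>V. V \<subseteq> p ` topspace T \<and> openin T {x \<in> topspace T. p x \<in> V})"
    unfolding istopology_def
  proof (intro conjI allI impI)
    fix A B
    assume A: "A \<subseteq> p ` topspace T \<and> openin T {x \<in> topspace T. p x \<in> A}"
      and B: "B \<subseteq> p ` topspace T \<and> openin T {x \<in> topspace T. p x \<in> B}"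
    show "A \<inter> B \<subseteq> p ` topspace T" using A by blast
    have "{x \<in> topspace T. p x \<in> A \<inter> B} =
      {x \<in> topspace T. p x \<in> A} \<inter> {x \<in> topspace T. p x \<in> B}" by auto
    then show "openin T {x \<in> topspace T. p x \<in> A \<inter> B}" using A B by auto
  next
    fix K
    assume K: "\<forall>V\<in>K. V \<subseteq> p ` topspace T \<and> openin T {x \<in> topspace T. p x \<in> V}"
    show "\<Union>K \<subseteq> p ` topspace T" using K by blast
    have "{x \<in> topspace T. p x \<in> \<Union>K} = (\<Union>V\<in>K. {x \<in> topspace T. p x \<in> V})" by auto
    then show "openin T {x \<in> topspace T. p x \<in> \<Union>K}" using K by auto
  qed
  then show ?thesis
    by (simp add: quotient_topology_def)
qed

lemma quotient_map_quotient_topology: "quotient_map T (quotient_topology T p) p"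
proof -
  have "openin (quotient_topology T p) (p ` topspace T)"
  proof -
    have "{x \<in> topspace T. p x \<in> p ` topspace T} = topspace T" by auto
    then show ?thesis by (simp add: openin_quotient_topology)
  qed
  then have "topspace (quotient_topology T p) = p ` topspace T"
    by (metis openin_quotient_topology openin_subset openin_topspace subset_antisym)
  then show ?thesis
    by (auto simp: quotient_map_def openin_quotient_topology)
qed

text \<open>
  An element \<open>((a, b), (a', b'))\<close> of \<open>G\<close> glues the edge from \<open>a\<close> to \<open>b\<close> to the edge from \<open>a'\<close>
  to \<open>b'\<close> by the translation taking \<open>a\<close> to \<open>a'\<close>; it is meant that \<open>b' - a' = b - a\<close>.
\<close>

type_synonym gluing = "(complex \<times> complex) \<times> (complex \<times> complex)"

definition glue_rel :: "gluing set \<Rightarrow> (complex \<times> complex) set" where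
  "glue_rel G = {(z, z + (a' - a)) | z a b a' b'. ((a, b), (a', b')) \<in> G \<and> z \<in> closed_segment a b}"

definition glue_class :: "gluing set \<Rightarrow> complex \<Rightarrow> complex set" where
  "glue_class G z = (glue_rel G \<union> (glue_rel G)\<inverse>)\<^sup>* `` {z}"

text \<open>
  \<open>P\<close> is the closed region formed by the polygons and \<open>p\<close> the projection to the glued surface.
  The complex structure is the one whose coordinates are the homeomorphisms from open subsets of
  the surface to open subsets of the plane that are holomorphic in the interior of \<open>P\<close>;
  holomorphy at the glued edges is automatic by continuity, and the finitely many points coming from
  vertices are removable singularities. The form is the one that pulls back to \<open>dz\<close> on the
  interior of \<open>P\<close>: \<open>f(w) dw = dz\<close> for \<open>w = \<phi> (p z)\<close>. At a point of cone angle \<open>2\<pi>(k + 1)\<close> the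
  coordinates include the local \<open>(k + 1)\<close>-st roots of \<open>z - z\<^sub>0\<close>, in which \<open>\<omega> = (k + 1) w^k dw\<close>.
\<close>

definition glued_surface :: "complex set \<Rightarrow> gluing set \<Rightarrow> complex set form_surface" where
  "glued_surface P G =
     (let p = glue_class G; X = quotient_topology (top_of_set P) p in
      \<lparr> surface = X,
        form_charts = {(U, \<phi>, f).
          openin X U \<and> open (\<phi> ` U) \<and>
          homeomorphic_map (subtopology X U) (top_of_set (\<phi> ` U)) \<phi> \<and>
          f holomorphic_on \<phi> ` U \<and>
          (\<forall>z \<in> interior P. p z \<in> U \<longrightarrow>
            (\<exists>D. ((\<lambda>u. \<phi> (p u)) has_field_derivative D) (at z) \<and> f (\<phi> (p z)) * D = 1))} \<rparr>)"


section \<open>The golden L\<close>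

definition golden_ratio :: real where
  "golden_ratio = (1 + sqrt 5) / 2"

definition golden_polygon :: "complex set" where
  "golden_polygon =
     {z. Re z \<in> {0..golden_ratio} \<and> Im z \<in> {0..1}} \<union>
     {z. Re z \<in> {0..1} \<and> Im z \<in> {0..golden_ratio}}"

definition golden_gluings :: "gluing set" where
  "golden_gluings =
    {((Complex 0 0, Complex 1 0), (Complex 0 golden_ratio, Complex 1 golden_ratio)),
     ((Complex 1 0, Complex golden_ratio 0), (Complex 1 1, Complex golden_ratio 1)),
     ((Complex 0 0, Complex 0 1), (Complex golden_ratio 0, Complex golden_ratio 1)),
     ((Complex 0 1, Complex 0 golden_ratio), (Complex 1 1, Complex 1 golden_ratio))}"

definition golden_L :: "complex set form_surface" where
  "golden_L = glued_surface golden_polygon golden_gluings"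

end

theory Submission
  imports Defs
begin

text \<open>
  Write \<open>g\<close> for the golden ratio. Both decompositions of the golden L into cylinders, the horizontal
  and the vertical one, have all moduli equal to \<open>g\<close>, so the shears \<open>(x, y) \<mapsto> (x + n g y, y)\<close> are
  derivatives of affine automorphisms, and so is the reflection in the diagonal. Periods of saddle
  connections are therefore permuted by these linear maps (\<open>flat_saddle_shear\<close> and
  \<open>flat_saddle_mirror\<close>). Starting from the period \<open>(g - 1, 0)\<close> of a horizontal edge one obtains the
  periods \<open>(a + k g b, b)\<close> with \<open>b = (m + 1) + m n g\<^sup>2\<close>, \<open>a = g - 1 + m n g\<close> and arbitrary integers
  \<open>m\<close>, \<open>n\<close>, \<open>k\<close> (\<open>saddle_period_family\<close>): at each height \<open>b\<close> of this kind there is a whole arithmetic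
  progression of periods, of step \<open>g b\<close>.
  
  Unbounded bunching follows from choosing \<open>K\<close> different heights \<open>b\<^sub>1, \<dots>, b\<^sub>K\<close> within \<open>1/4\<close> of each
  other such that the \<open>K\<close> progressions have terms that are simultaneously close to one point. Since the
  heights span a space of dimension at most two over the rationals, this is not a matter of independence.
  It is forced instead by arithmetic in \<open>\<int>[g]\<close>. If \<open>b\<^sub>i'\<close> is the conjugate of \<open>b\<^sub>i\<close> and \<open>N\<^sub>i = b\<^sub>i b\<^sub>i'\<close>
  its norm, then for \<open>\<lambda>\<close> in \<open>\<int>[g]\<close> the number \<open>\<lambda> / b\<^sub>i\<close> equals \<open>(X + Y g) / N\<^sub>i\<close> with integers \<open>X\<close>
  and \<open>Y\<close>. Multiplying by an integer \<open>\<tau>\<close> that is divisible by all norms, and for which \<open>\<tau> g\<close> is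
  close to 1 modulo all norms, turns it into \<open>Y / N\<^sub>i\<close>, up to an integer and a small error. By the
  Chinese remainder theorem the residues of \<open>Y\<close> modulo the different \<open>N\<^sub>i\<close> can be prescribed
  independently when the heights are pairwise comaximal, up to a factor \<open>m + 1\<close>. The resulting
  resolution \<open>(m + 1) / N\<^sub>i\<close> is finer than the tolerance, which is of the order \<open>1 / b\<^sub>i\<close>, as soon as
  \<open>b\<^sub>i'\<close> is large compared to \<open>m + 1\<close> (\<open>progressions_meet_in_unit_interval\<close>).
  
  Suitable heights form an arithmetic progression in \<open>\<int>[g]\<close> whose difference is \<open>K!\<close> times a very
  small unit and whose terms are congruent to a unit modulo \<open>K!\<close>; such numbers are pairwise comaximal
  for the same reason as in Goedel's beta function (\<open>close_comaximal_heights\<close>).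
\<close>

section \<open>The golden L as a quotient\<close>

abbreviation gr :: real where "gr \<equiv> golden_ratio"

lemma gr_square: "gr * gr = gr + 1"
  unfolding golden_ratio_def by (simp add: field_simps)

lemma gr_bounds: "1 < gr" "gr < 2"
proof -
  have "sqrt 5 > 1" "sqrt 5 < 3" by (simp_all add: real_less_rsqrt real_less_lsqrt)
  then show "1 < gr" "gr < 2" by (simp_all add: golden_ratio_def)
qed

abbreviation proj :: "complex \<Rightarrow> complex set" where
  "proj \<equiv> glue_class golden_gluings"

abbreviation GL :: "complex set topology" where
  "GL \<equiv> quotient_topology (top_of_set golden_polygon) proj"

lemma surface_golden_L [simp]: "surface golden_L = GL"
  by (simp add: golden_L_def glued_surface_def Let_def)

lemma complex_on_segment_vertical:
  "z \<in> closed_segment (Complex a c) (Complex a d) \<longleftrightarrow> Re z = a \<and> Im z \<in> closed_segment c d"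
  by (auto simp: closed_segment_def complex_eq_iff algebra_simps) 

lemma complex_on_segment_horizontal:
  "z \<in> closed_segment (Complex c a) (Complex d a) \<longleftrightarrow> Im z = a \<and> Re z \<in> closed_segment c d"
  by (auto simp: closed_segment_def complex_eq_iff algebra_simps) 

lemma glue_rel_golden:
  "(z, z') \<in> glue_rel golden_gluings \<longleftrightarrow>
     (Im z = 0 \<and> 0 \<le> Re z \<and> Re z \<le> 1 \<and> z' = z + Complex 0 gr) \<or>
     (Im z = 0 \<and> 1 \<le> Re z \<and> Re z \<le> gr \<and> z' = z + Complex 0 1) \<or>
     (Re z = 0 \<and> 0 \<le> Im z \<and> Im z \<le> 1 \<and> z' = z + Complex gr 0) \<or>
     (Re z = 0 \<and> 1 \<le> Im z \<and> Im z \<le> gr \<and> z' = z + Complex 1 0)"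
proof -
  have "(z, z') \<in> glue_rel golden_gluings \<longleftrightarrow>
     (z \<in> closed_segment (Complex 0 0) (Complex 1 0) \<and> z' = z + (Complex 0 gr - Complex 0 0)) \<or>
     (z \<in> closed_segment (Complex 1 0) (Complex gr 0) \<and> z' = z + (Complex 1 1 - Complex 1 0)) \<or>
     (z \<in> closed_segment (Complex 0 0) (Complex 0 1) \<and> z' = z + (Complex gr 0 - Complex 0 0)) \<or>
     (z \<in> closed_segment (Complex 0 1) (Complex 0 gr) \<and> z' = z + (Complex 1 1 - Complex 0 1))"
    unfolding glue_rel_def golden_gluings_def by blast
  then show ?thesis using gr_bounds
    by (auto simp: complex_on_segment_vertical complex_on_segment_horizontal closed_segment_eq_real_ivl complex_eq_iff)
qed

definition glue_eq :: "(complex \<times> complex) set" where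
  "glue_eq = (glue_rel golden_gluings \<union> (glue_rel golden_gluings)\<inverse>)\<^sup>*"

lemma proj_eq_glue_eq: "proj z = glue_eq `` {z}"
  by (simp add: glue_class_def glue_eq_def)

lemma proj_eq_iff: "proj z = proj z' \<longleftrightarrow> (z, z') \<in> glue_eq"
proof
  assume "proj z = proj z'"
  moreover have "z' \<in> proj z'" by (simp add: proj_eq_glue_eq glue_eq_def)
  ultimately have "z' \<in> proj z" by simp
  then show "(z, z') \<in> glue_eq" by (simp add: proj_eq_glue_eq)
next
  have tr: "trans glue_eq" unfolding glue_eq_def by (rule trans_rtrancl)
  have sy: "sym glue_eq" unfolding glue_eq_def by (simp add: sym_rtrancl sym_Un_converse)
  assume "(z, z') \<in> glue_eq"
  then show "proj z = proj z'" 
    using tr sy unfolding proj_eq_glue_eq by (auto elim: transE symE)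
qed

lemma mem_proj_iff: "z' \<in> proj z \<longleftrightarrow> proj z = proj z'"
  by (simp add: proj_eq_iff) (simp add: proj_eq_glue_eq)

text \<open>
  Points of the polygon are told apart on the surface by exhibiting functions that the gluings respect.
\<close>

lemma proj_invariant:
  assumes inv: "\<And>z z'. (z, z') \<in> glue_rel golden_gluings \<Longrightarrow> f z = f z'"
    and "proj z = proj z'"
  shows "f z = f z'"
proof -
  have "(z, z') \<in> (glue_rel golden_gluings \<union> (glue_rel golden_gluings)\<inverse>)\<^sup>*"
    using assms(2) by (simp add: proj_eq_iff glue_eq_def)
  then show ?thesis
    by (induction rule: rtrancl_induct) (use inv in \<open>auto dest: inv\<close>)
qed

lemma proj_step: "(z, z') \<in> glue_rel golden_gluings \<Longrightarrow> proj z = proj z'"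
  unfolding proj_eq_iff glue_eq_def by blast

lemma proj_glue:
  "0 \<le> x \<Longrightarrow> x \<le> 1 \<Longrightarrow> proj (Complex x gr) = proj (Complex x 0)"
  "1 \<le> x \<Longrightarrow> x \<le> gr \<Longrightarrow> proj (Complex x 1) = proj (Complex x 0)"
  "0 \<le> y \<Longrightarrow> y \<le> 1 \<Longrightarrow> proj (Complex gr y) = proj (Complex 0 y)"
  "1 \<le> y \<Longrightarrow> y \<le> gr \<Longrightarrow> proj (Complex 1 y) = proj (Complex 0 y)"
  by (rule proj_step[symmetric]; simp add: glue_rel_golden complex_eq_iff)+

lemma proj_vertices:
  "proj (Complex 1 0) = proj 0" "proj (Complex gr 0) = proj 0"
proof -
  show g: "proj (Complex gr 0) = proj 0" using proj_glue(3)[of 0] by (simp add: zero_complex.ctr)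
  show "proj (Complex 1 0) = proj 0"
    using proj_glue(1)[of 1] proj_glue(4)[of gr] proj_glue(1)[of 0] gr_bounds by (simp add: zero_complex.ctr)
qed

section \<open>The reflection in the diagonal\<close>

definition mirror :: "complex \<Rightarrow> complex" where "mirror z = Complex (Im z) (Re z)"

lemma mirror_simps [simp]: "Re (mirror z) = Im z" "Im (mirror z) = Re z" "mirror (mirror z) = z"
  "mirror (Complex x y) = Complex y x"
  by (simp_all add: mirror_def)

lemma mirror_add: "mirror (z + w) = mirror z + mirror w"
  by (simp add: mirror_def complex_eq_iff)

lemma mirror_0 [simp]: "mirror 0 = 0"
  by (simp add: complex_eq_iff)

lemma mirror_scaleR: "mirror (r *\<^sub>R w) = r *\<^sub>R mirror w"
  by (simp add: mirror_def complex_eq_iff)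

lemma bounded_linear_mirror: "bounded_linear mirror"
  by (rule bounded_linear_intro[of _ 1]) (simp_all add: mirror_add mirror_scaleR, simp add: cmod_def add.commute)

lemma continuous_on_mirror [continuous_intros]: "continuous_on S f \<Longrightarrow> continuous_on S (\<lambda>x. mirror (f x))"
  using bounded_linear.continuous_on[OF bounded_linear_mirror] .

lemma filterlim_mirror: "filterlim mirror (nhds 0) (nhds 0)"
  using bounded_linear.tendsto[OF bounded_linear_mirror filterlim_ident[of "nhds 0"]] by simp

lemma mirror_in_golden_polygon: "mirror z \<in> golden_polygon \<longleftrightarrow> z \<in> golden_polygon"
  by (auto simp: golden_polygon_def)

definition mirror_map :: "complex set \<Rightarrow> complex set" where "mirror_map C = mirror ` C"

lemma mirror_map_involution [simp]: "mirror_map (mirror_map C) = C"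
  by (force simp: mirror_map_def image_image)

lemma proj_mirror_cong: "proj z = proj z' \<Longrightarrow> proj (mirror z) = proj (mirror z')"
proof (rule proj_invariant[of "\<lambda>z. proj (mirror z)"], rule proj_step)
  show "(mirror z, mirror z') \<in> glue_rel golden_gluings" if "(z, z') \<in> glue_rel golden_gluings" for z z'
    using that by (auto simp: glue_rel_golden complex_eq_iff)
qed

lemma mirror_map_proj [simp]: "mirror_map (proj z) = proj (mirror z)"
proof -
  have "w \<in> mirror ` proj z \<longleftrightarrow> mirror w \<in> proj z" for w by (force simp: image_iff intro: bexI[of _ "mirror w"])
  also have "\<dots>w \<longleftrightarrow> w \<in> proj (mirror z)" for w
    unfolding mem_proj_iff using proj_mirror_cong[of z "mirror w"] proj_mirror_cong[of "mirror z" w] by auto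
  finally show ?thesis unfolding mirror_map_def by blast
qed

section \<open>The topology of the surface\<close>

lemma quotient_map_proj: "quotient_map (top_of_set golden_polygon) GL proj"
  by (rule quotient_map_quotient_topology)

lemma topspace_GL: "topspace GL = proj ` golden_polygon"
  using quotient_map_proj by (simp add: quotient_map_def)

lemma continuous_map_proj: "continuous_map (top_of_set golden_polygon) GL proj"
  using quotient_map_proj by (rule quotient_imp_continuous_map)

lemma openin_GL:
  "openin GL V \<longleftrightarrow> V \<subseteq> proj ` golden_polygon \<and> openin (top_of_set golden_polygon) {x \<in> golden_polygon. proj x \<in> V}"
  by (simp add: openin_quotient_topology)

lemma continuous_map_mirror_map: "continuous_map GL GL mirror_map"
proof -
  have "continuous_map (top_of_set golden_polygon) GL (proj \<circ> mirror)"
    by (rule continuous_map_compose[OF _ continuous_map_proj])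
       (auto simp: mirror_in_golden_polygon intro!: continuous_intros)
  moreover have "proj \<circ> mirror = mirror_map \<circ> proj" by (auto simp: fun_eq_iff)
  ultimately show ?thesis
    using continuous_compose_quotient_map_eq[OF quotient_map_proj] by metis
qed

lemma openin_mirror_map: "openin GL V \<Longrightarrow> openin GL (mirror_map ` V)"
proof -
  assume V: "openin GL V"
  have "mirror_map ` V = {x \<in> topspace GL. mirror_map x \<in> V}"
    using openin_subset[OF V] continuous_map_funspace[OF continuous_map_mirror_map]
    by (force simp: image_iff intro: bexI[of _ "mirror_map _"])
  then show ?thesis using openin_continuous_map_preimage[OF continuous_map_mirror_map V] by simp
qed

section \<open>Horizontal cylinders\<close>

text \<open>
  The closed horizontal strip of width \<open>l\<close> wraps around the surface with period \<open>l\<close>. For \<open>l = g\<close> this is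
  the cylinder over the bottom rectangle, for \<open>l = 1\<close> the one over the top rectangle.
\<close>

definition hstrip :: "real \<Rightarrow> complex \<Rightarrow> complex set" where
  "hstrip l z = proj (Complex (Re z - l * of_int \<lfloor>Re z / l\<rfloor>) (Im z))"

lemma hstrip_shift:
  assumes "0 < l" shows "hstrip l (z + of_real (l * of_int k)) = hstrip l z"
proof -
  have "(Re z + l * of_int k) / l = Re z / l + of_int k" using assms by (simp add: field_simps)
  then have "\<lfloor>(Re z + l * of_int k) / l\<rfloor> = \<lfloor>Re z / l\<rfloor> + k" by (metis floor_add_int)
  then show ?thesis by (simp add: hstrip_def algebra_simps)
qed

lemma hstrip_eq_proj:
  assumes "0 < l" "0 \<le> Re z" "Re z \<le> l" and glue: "proj (Complex l (Im z)) = proj (Complex 0 (Im z))"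
  shows "hstrip l z = proj z"
proof (cases "Re z = l")
  case True
  then show ?thesis using assms by (simp add: hstrip_def) (metis complex.collapse)
next
  case False
  then have "\<lfloor>Re z / l\<rfloor> = 0" using assms by (intro floor_unique) auto
  then show ?thesis by (simp add: hstrip_def)
qed

text \<open>
  Near a point whose real part is a multiple of \<open>l\<close> the map is pasted from two translates of the
  projection, which agree on the vertical line because its two copies in the rectangle are glued.
\<close>

lemma continuous_map_hstrip:
  assumes l: "0 < l"
    and rect: "{z. 0 \<le> Re z \<and> Re z \<le> l \<and> a \<le> Im z \<and> Im z \<le> b} \<subseteq> golden_polygon"
    and glue: "\<And>y. a \<le> y \<Longrightarrow> y \<le> b \<Longrightarrow> proj (Complex l y) = proj (Complex 0 y)"
  shows "continuous_map (top_of_set {z. a \<le> Im z \<and> Im z \<le> b}) GL (hstrip l)"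
proof -
  define S where "S = {z. a \<le> Im z \<and> Im z \<le> b}"
  define T where "T k = {z \<in> S. l * of_int (k - 1) < Re z \<and> Re z < l * of_int (k + 1)}" for k :: int
  have shift: "hstrip l z = proj (z - of_real (l * of_int k))" 
    if "z \<in> S" "l * of_int k \<le> Re z" "Re z \<le> l * of_int (k + 1)" for z k
  proof -
    have "hstrip l z = hstrip l (z - of_real (l * of_int k))"
      using hstrip_shift[OF l, of "z - of_real (l * of_int k)" k] by simp
    also have "\<dots> = proj (z - of_real (l * of_int k))"
      using that glue[of "Im z"] by (intro hstrip_eq_proj l) (simp_all add: S_def algebra_simps)
    finally show ?thesis .
  qed
  have cont: "continuous_map (top_of_set {z \<in> S. l * of_int k \<le> Re z \<and> Re z \<le> l * of_int (k + 1)}) GL (hstrip l)" for k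
  proof (rule continuous_map_eq)
    have "(\<lambda>z. z - of_real (l * of_int k)) \<in> {z \<in> S. l * of_int k \<le> Re z \<and> Re z \<le> l * of_int (k + 1)} \<rightarrow> golden_polygon"
      using rect by (auto simp: S_def subset_iff algebra_simps)
    then show "continuous_map (top_of_set {z \<in> S. l * of_int k \<le> Re z \<and> Re z \<le> l * of_int (k + 1)}) GL 
       (proj \<circ> (\<lambda>z. z - of_real (l * of_int k)))"
      by (intro continuous_map_compose[OF _ continuous_map_proj])
         (auto simp: image_subset_iff_funcset intro!: continuous_intros)
  qed (auto simp: shift)
  have "continuous_map (top_of_set S) GL (hstrip l)"
  proof (rule pasting_lemma[where I = UNIV and T = T and f = "\<lambda>_. hstrip l"])
    fix k :: int
    show "openin (top_of_set S) (T k)"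
    proof -
      have "T k = S \<inter> {z. l * of_int (k - 1) < Re z \<and> Re z < l * of_int (k + 1)}" by (auto simp: T_def)
      moreover have "open {z. l * of_int (k - 1) < Re z \<and> Re z < l * of_int (k + 1)}"
        by (intro open_Collect_conj open_Collect_less continuous_intros)
      ultimately show ?thesis by (simp add: openin_open_Int)
    qed
    have "continuous_map (top_of_set (T k)) GL (\<lambda>z. if Re z \<le> l * of_int k then hstrip l z else hstrip l z)"
    proof (rule continuous_map_cases_le)
      have "continuous_map (top_of_set {z \<in> T k. Re z \<le> l * of_int k}) GL (hstrip l)"
        by (rule continuous_map_from_subtopology_mono[OF cont[of "k - 1"]]) (auto simp: T_def)
      then show "continuous_map (subtopology (top_of_set (T k)) {z \<in> topspace (top_of_set (T k)). Re z \<le> l * of_int k}) GL (hstrip l)"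
        by (simp add: subtopology_subtopology Int_absorb1[OF Collect_subset[of "T k"]])
      have "continuous_map (top_of_set {z \<in> T k. l * of_int k \<le> Re z}) GL (hstrip l)"
        by (rule continuous_map_from_subtopology_mono[OF cont[of "k"]]) (auto simp: T_def)
      then show "continuous_map (subtopology (top_of_set (T k)) {z \<in> topspace (top_of_set (T k)). l * of_int k \<le> Re z}) GL (hstrip l)"
        by (simp add: subtopology_subtopology Int_absorb1[OF Collect_subset[of "T k"]])
    qed (auto intro!: continuous_intros)
    moreover have "subtopology (top_of_set S) (T k) = top_of_set (T k)"
      by (auto simp: subtopology_subtopology T_def Int_def intro!: arg_cong[where f=top_of_set])
    ultimately show "continuous_map (subtopology (top_of_set S) (T k)) GL (hstrip l)"
      by simp
  next
    fix z assume "z \<in> topspace (top_of_set S)"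
    moreover have "z \<in> T \<lfloor>Re z / l\<rfloor>" if "z \<in> S"
    proof -
      have "of_int \<lfloor>Re z / l\<rfloor> \<le> Re z / l" "Re z / l < of_int \<lfloor>Re z / l\<rfloor> + 1" by linarith+
      then have "l * of_int \<lfloor>Re z / l\<rfloor> \<le> Re z" "Re z < l * of_int \<lfloor>Re z / l\<rfloor> + l"
        using l by (simp_all only: pos_le_divide_eq pos_divide_less_eq ring_distribs mult.commute mult_1)
      then show ?thesis using l that
        by (simp add: T_def algebra_simps)
    qed
    ultimately show "\<exists>j. j \<in> UNIV \<and> z \<in> T j \<and> hstrip l z = hstrip l z" by auto
  qed auto
  then show ?thesis by (simp add: S_def)
qed

text \<open>
  The open cylinders carry no zeros. Both are parametrized at once, the circumference being a function of
  the height; their boundaries, at heights 0, 1 and \<open>g\<close>, are left out.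
\<close>

definition hdom :: "complex set" where
  "hdom = {z. 0 < Im z \<and> Im z < gr \<and> Im z \<noteq> 1}"

definition circumference :: "complex \<Rightarrow> real" where
  "circumference z = (if Im z < 1 then gr else 1)"

definition hcyl :: "complex \<Rightarrow> complex set" where
  "hcyl z = hstrip (circumference z) z"

lemma circumference_cong: "Im z = Im w \<Longrightarrow> circumference z = circumference w"
  by (simp add: circumference_def)

lemma circumference_pos: "0 < circumference z" "1 \<le> circumference z"
  using gr_bounds by (auto simp: circumference_def)

lemma hcyl_shift: "hcyl (z + of_real (circumference z * of_int k)) = hcyl z"
  using hstrip_shift[OF circumference_pos(1), of z z k] by (simp add: hcyl_def circumference_def)

lemma open_hdom: "open hdom"
  unfolding hdom_def by (intro open_Collect_conj open_Collect_less open_Collect_neq continuous_intros)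

lemma continuous_map_hstrip_bottom: "continuous_map (top_of_set {z. 0 \<le> Im z \<and> Im z \<le> 1}) GL (hstrip gr)"
  using gr_bounds by (intro continuous_map_hstrip) (auto simp: golden_polygon_def proj_glue)

lemma continuous_map_hstrip_top: "continuous_map (top_of_set {z. 1 \<le> Im z \<and> Im z \<le> gr}) GL (hstrip 1)"
  using gr_bounds by (intro continuous_map_hstrip) (auto simp: golden_polygon_def proj_glue)

lemma hstrip_bottom_eq_proj:
  assumes "z \<in> golden_polygon" "Im z \<le> 1" shows "hstrip gr z = proj z"
  using assms gr_bounds by (intro hstrip_eq_proj proj_glue) (auto simp: golden_polygon_def)

lemma hstrip_top_eq_proj:
  assumes "z \<in> golden_polygon" "1 \<le> Im z" "Re z \<le> 1" shows "hstrip 1 z = proj z"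
  using assms gr_bounds by (intro hstrip_eq_proj proj_glue) (auto simp: golden_polygon_def)

lemma hcyl_eq_proj:
  assumes "z \<in> golden_polygon" "Im z \<noteq> 1" shows "hcyl z = proj z"
  using assms hstrip_bottom_eq_proj[of z] hstrip_top_eq_proj[of z] 
  by (auto simp: hcyl_def circumference_def golden_polygon_def)

lemma hcyl_representative:
  assumes "w \<in> hdom"
  obtains k u where "u \<in> hdom" "u \<in> golden_polygon" "hcyl w = proj u" "w = u + of_real (circumference w * of_int k)"
proof -
  define k where "k = \<lfloor>Re w / circumference w\<rfloor>"
  define u where "u = w - of_real (circumference w * of_int k)"
  have "of_int k \<le> Re w / circumference w" "Re w / circumference w < of_int k + 1" unfolding k_def by linarith+
  then have "0 \<le> Re u" "Re u \<le> circumference w" 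
    using circumference_pos(1)[of w] by (auto simp: u_def field_simps)
  then have "u \<in> hdom" "u \<in> golden_polygon"
    using assms by (auto simp: hdom_def golden_polygon_def u_def circumference_def split: if_splits)
  moreover have "hcyl w = proj u"
    by (auto simp: hcyl_def hstrip_def u_def k_def intro!: arg_cong[where f=proj] complex_eqI)
  moreover have "w = u + of_real (circumference w * of_int k)" by (simp add: u_def)
  ultimately show thesis by (rule that)
qed

text \<open>
  The invariant used here is the pair of the height and the position along the cylinder modulo the
  circumference.
\<close>

lemma proj_eq_in_hdom:
  assumes "proj u = proj w" "w \<in> hdom"
  obtains k where "u \<in> hdom" "w = u + of_real (circumference u * of_int k)"
proof -
  define f where "f z = (if z \<in> hdom then Some (Re z - circumference z * of_int \<lfloor>Re z / circumference z\<rfloor>, Im z) else None)" for z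
  have "f u = f w"
  proof (rule proj_invariant[of f, OF _ assms(1)])
    fix z z' assume "(z, z') \<in> glue_rel golden_gluings"
    then show "f z = f z'"
      unfolding f_def using gr_bounds 
      by (auto simp: glue_rel_golden hdom_def circumference_def)
  qed
  then have "u \<in> hdom" "Re u - circumference u * of_int \<lfloor>Re u / circumference u\<rfloor> = Re w - circumference w * of_int \<lfloor>Re w / circumference w\<rfloor>" "Im u = Im w"
    using assms(2) by (auto simp: f_def split: if_splits)
  moreover from this have "circumference u = circumference w" by (simp add: circumference_def)
  ultimately show thesis
    using that[of "\<lfloor>Re w / circumference w\<rfloor> - \<lfloor>Re u / circumference u\<rfloor>"]
    by (auto simp: complex_eq_iff algebra_simps)
qed

lemma proj_eq_hcyl:
  assumes "proj u = hcyl w" "w \<in> hdom"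
  obtains k where "u \<in> hdom" "w = u + of_real (circumference u * of_int k)"
proof -
  obtain k v where v: "v \<in> hdom" "hcyl w = proj v" "w = v + of_real (circumference w * of_int k)"
    using assms(2) hcyl_representative by metis
  obtain j where j: "u \<in> hdom" "v = u + of_real (circumference u * of_int j)"
    using assms(1) v proj_eq_in_hdom by metis
  have "circumference w = circumference v" using v(3) by (intro circumference_cong) (metis Im_complex_of_real add.right_neutral plus_complex.sel(2))
  moreover have "circumference v = circumference u" using j(2) by (intro circumference_cong) (metis Im_complex_of_real add.right_neutral plus_complex.sel(2))
  ultimately show thesis using that[of "j + k"] j v(3) by (simp add: algebra_simps)
qed

lemma hcyl_inj:
  assumes "hcyl w = hcyl w'" "w \<in> hdom" "w' \<in> hdom"
  obtains k where "w' = w + of_real (circumference w * of_int k)"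
proof -
  obtain k v where v: "v \<in> hdom" "hcyl w = proj v" "w = v + of_real (circumference w * of_int k)"
    using assms(2) hcyl_representative by metis
  obtain j where j: "w' = v + of_real (circumference v * of_int j)"
    using assms v proj_eq_hcyl by metis
  have "circumference w = circumference v" using v(3) by (intro circumference_cong) (metis Im_complex_of_real add.right_neutral plus_complex.sel(2))
  then show thesis using that[of "j - k"] j v(3) by (simp add: algebra_simps)
qed

lemma hcyl_inj_on_ball:
  assumes "ball w (1/2) \<supseteq> B" "B \<subseteq> hdom" shows "inj_on hcyl B"
proof (rule inj_onI)
  fix u v assume uv: "u \<in> B" "v \<in> B" "hcyl u = hcyl v"
  then have "u \<in> hdom" "v \<in> hdom" using assms by auto
  with uv(3) obtain k where k: "v = u + of_real (circumference u * of_int k)" by (rule hcyl_inj)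
  have "dist u w < 1/2" "dist v w < 1/2" using uv assms by (auto simp: dist_commute subset_iff)
  then have "dist v u < 1" using dist_triangle_half_r[of w u 1 v] by (simp add: dist_commute)
  then have "\<bar>circumference u * of_int k\<bar> < 1" by (simp only: k dist_norm add_diff_cancel_left'  norm_of_real)
  then have "circumference u * \<bar>of_int k\<bar> < 1" using circumference_pos(1)[of u] by (simp add: abs_mult)
  moreover have "1 * \<bar>of_int k::real\<bar> \<le> circumference u * \<bar>of_int k\<bar>" using circumference_pos(2)[of u] by (intro mult_right_mono) auto
  ultimately have "k = 0" by linarith
  then show "u = v" using k by simp
qed

text \<open>
  The preimage of the image in the polygon is cut out by the integer translates of \<open>W\<close>, by whichever
  circumference applies below and above height 1.
\<close>

lemma openin_hcyl:
  assumes "open W" "W \<subseteq> hdom" shows "openin GL (hcyl ` W)"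
  unfolding openin_GL
proof
  show "hcyl ` W \<subseteq> proj ` golden_polygon"
    using assms(2) by (blast elim: hcyl_representative)
  define V where "V k = ({u. Im u < 1} \<inter> (\<lambda>u. u + of_real (gr * of_int k)) -` W) \<union> ({u. 1 < Im u} \<inter> (\<lambda>u. u + of_real (of_int k)) -` W)" for k :: int
  have "open (V k)" for k
    unfolding V_def using assms(1)
    by (intro open_Un open_Int open_vimage open_Collect_less continuous_intros) auto
  moreover have "{x \<in> golden_polygon. proj x \<in> hcyl ` W} = golden_polygon \<inter> (\<Union>k. V k)"
  proof (intro equalityI subsetI; clarsimp)
    fix u w assume u: "u \<in> golden_polygon" "proj u = hcyl w" "w \<in> W"
    then obtain k where k: "u \<in> hdom" "w = u + of_real (circumference u * of_int k)" using proj_eq_hcyl assms(2) by blast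
    then have "Im u < 1 \<or> 1 < Im u" by (auto simp: hdom_def)
    then show "\<exists>k. u \<in> V k" using k u(3) by (intro exI[of _ k]) (auto simp: V_def circumference_def)
  next
    fix u k assume u: "u \<in> golden_polygon" "u \<in> V k"
    then have w: "u + of_real (circumference u * of_int k) \<in> W" by (auto simp: V_def circumference_def)
    have "Im u \<noteq> 1" using u by (auto simp: V_def)
    then have "proj u = hcyl (u + of_real (circumference u * of_int k))" using hcyl_shift[of u k] hcyl_eq_proj[OF u(1)] by metis
    then show "proj u \<in> hcyl ` W" using w by blast
  qed
  moreover have "open (\<Union>k. V k)" using calculation(1) by blast
  ultimately show "openin (top_of_set golden_polygon) {x \<in> golden_polygon. proj x \<in> hcyl ` W}"
    by (simp add: openin_open_Int)
qed

lemma continuous_map_hcyl: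
  assumes "B \<subseteq> hdom" "connected B" shows "continuous_map (top_of_set B) GL hcyl"
proof -
  have disj: "B \<subseteq> {z. Im z < 1} \<or> B \<subseteq> {z. Im z > 1}"
  proof (rule ccontr)
    assume "\<not> ?thesis"
    then obtain z' z where "z \<in> B" "z' \<in> B" "Im z \<le> 1" "1 \<le> Im z'" unfolding subset_iff mem_Collect_eq not_less not_all not_imp de_Morgan_disj by blast
    moreover have "connected (Im ` B)" using assms(2) by (intro connected_continuous_image continuous_intros)
    ultimately have "1 \<in> Im ` B" unfolding connected_iff_interval by blast
    then show False using assms by (auto simp: hdom_def)
  qed
  then show ?thesis
  proof
    assume B: "B \<subseteq> {z. Im z < 1}"
    have "continuous_map (top_of_set B) GL (hstrip gr)"
      using assms(1) B by (intro continuous_map_from_subtopology_mono[OF continuous_map_hstrip_bottom]) (auto simp: hdom_def)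
    then show ?thesis by (rule continuous_map_eq) (use B in \<open>auto simp: hcyl_def circumference_def\<close>)
  next
    assume B: "B \<subseteq> {z. Im z > 1}"
    have "continuous_map (top_of_set B) GL (hstrip 1)"
      using assms(1) B by (intro continuous_map_from_subtopology_mono[OF continuous_map_hstrip_top]) (auto simp: hdom_def)
    then show ?thesis by (rule continuous_map_eq) (use B in \<open>force simp: hcyl_def circumference_def\<close>)
  qed
qed

lemma eventually_translate: 
  assumes "open S" "(w::complex) \<in> S" shows "\<forall>\<^sub>F d in nhds 0. w + d \<in> S"
proof -
  have "\<forall>\<^sub>F x in nhds w. x \<in> S" using assms eventually_nhds by blast
  moreover have "filterlim (\<lambda>d. w + d) (nhds w) (nhds 0)" using tendsto_add[OF tendsto_const[of w] filterlim_ident[of "nhds 0"]] by simp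
  ultimately show ?thesis using filterlim_iff by blast
qed

text \<open>
  Cylinder coordinates differ from the coordinates of the polygon by a local translation. This makes
  the inverses of \<open>hcyl\<close> charts in which \<open>\<omega> = dw\<close>.
\<close>

lemma proj_eq_hcyl_locally:
  assumes "proj z = hcyl w" "w \<in> hdom" "z \<in> interior golden_polygon"
  shows "\<forall>\<^sub>F d in nhds 0. proj (z + d) = hcyl (w + d)"
proof -
  obtain k where k: "z \<in> hdom" "w = z + of_real (circumference z * of_int k)" using assms proj_eq_hcyl by blast
  have "\<forall>\<^sub>F d in nhds 0. z + d \<in> interior golden_polygon \<inter> hdom \<inter> (if Im z < 1 then {z. Im z < 1} else {z. 1 < Im z})"
    using assms k by (intro eventually_translate open_Int open_hdom)
     (auto intro!: open_Collect_less continuous_intros simp: hdom_def)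
  then show ?thesis
  proof eventually_elim
    case (elim d)
    then have "circumference (z + d) = circumference z" by (auto simp: circumference_def split: if_splits)
    then have "w + d = (z + d) + of_real (circumference (z + d) * of_int k)" using k by simp
    then have "hcyl (w + d) = hcyl (z + d)" by (simp only: hcyl_shift)
    also have "\<dots> = proj (z + d)" using elim interior_subset by (intro hcyl_eq_proj) (auto simp: hdom_def)
    finally show ?case ..
  qed
qed

section \<open>Flat charts\<close>

lemma form_charts_golden_L:
  "(U, \<phi>, f) \<in> form_charts golden_L \<longleftrightarrow>
     openin GL U \<and> open (\<phi> ` U) \<and>
     homeomorphic_map (subtopology GL U) (top_of_set (\<phi> ` U)) \<phi> \<and>
     f holomorphic_on \<phi> ` U \<and>
     (\<forall>z \<in> interior golden_polygon. proj z \<in> U \<longrightarrow>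
        (\<exists>D. ((\<lambda>u. \<phi> (proj u)) has_field_derivative D) (at z) \<and> f (\<phi> (proj z)) * D = 1))"
  by (simp add: golden_L_def glued_surface_def Let_def)

lemma chart_of_parametrization:
  assumes B: "open B" and cont: "continuous_map (top_of_set B) GL q"
    and opn: "\<And>W. open W \<Longrightarrow> W \<subseteq> B \<Longrightarrow> openin GL (q ` W)"
    and inj: "inj_on q B"
    and loc: "\<And>z w. z \<in> interior golden_polygon \<Longrightarrow> w \<in> B \<Longrightarrow> proj z = q w \<Longrightarrow>
      \<forall>\<^sub>F d in nhds 0. proj (z + d) = q (w + d)"
  shows "(q ` B, inv_into B q, \<lambda>_. 1) \<in> form_charts golden_L"
proof -
  define h where "h = inv_into B q"
  have h: "h (q w) = w" if "w \<in> B" for w using that inj by (simp add: h_def)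
  have hB: "h ` q ` B = B" using h by force
  have sub: "q ` B \<subseteq> topspace GL" using opn[OF B] openin_subset by blast
  have "homeomorphic_map (top_of_set B) (subtopology GL (q ` B)) q"
  proof (rule bijective_open_imp_homeomorphic_map)
    show "continuous_map (top_of_set B) (subtopology GL (q ` B)) q"
      using cont by (simp add: continuous_map_in_subtopology)
    show "open_map (top_of_set B) (subtopology GL (q ` B)) q"
      unfolding open_map_def
    proof (intro allI impI)
      fix W assume "openin (top_of_set B) W"
      then have "open W" "W \<subseteq> B" using B by (auto simp: openin_open_eq)
      then show "openin (subtopology GL (q ` B)) (q ` W)"
        using opn[of W] by (auto simp: openin_subtopology)
    qed
    show "q ` topspace (top_of_set B) = topspace (subtopology GL (q ` B))" using sub by auto
  qed (use inj in auto)
  then obtain g where g: "homeomorphic_maps (top_of_set B) (subtopology GL (q ` B)) q g"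
    using homeomorphic_map_maps by blast
  then have "homeomorphic_map (subtopology GL (q ` B)) (top_of_set B) g"
    by (simp add: homeomorphic_maps_map)
  moreover have "g x = h x" if "x \<in> topspace (subtopology GL (q ` B))" for x
  proof -
    have "x \<in> q ` B" using that by simp
    then obtain w where "w \<in> B" "x = q w" by blast
    then show ?thesis using g h by (simp add: homeomorphic_maps_def)
  qed
  ultimately have hom: "homeomorphic_map (subtopology GL (q ` B)) (top_of_set B) h"
    by (rule homeomorphic_map_eq)
  have der: "((\<lambda>u. h (proj u)) has_field_derivative 1) (at z)" 
    if z: "z \<in> interior golden_polygon" "proj z \<in> q ` B" for z
  proof -
    obtain w where w: "w \<in> B" "proj z = q w" using z by blast
    have "\<forall>\<^sub>F d in nhds 0. h (proj (z + d)) = w + d"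
      using loc[OF z(1) w] eventually_translate[OF B w(1)] by eventually_elim (simp add: h)
    moreover have "filterlim (\<lambda>u. u - z) (nhds 0) (nhds z)"
      using tendsto_diff[OF filterlim_ident[of "nhds z"] tendsto_const[of z]] by simp
    ultimately have "\<forall>\<^sub>F u in nhds z. h (proj (z + (u - z))) = w + (u - z)"
      unfolding filterlim_iff by blast
    then have "\<forall>\<^sub>F u in nhds z. h (proj u) = w + (u - z)" by simp
    moreover have "((\<lambda>u. w + (u - z)) has_field_derivative 1) (at z)"
      by (auto intro!: derivative_eq_intros)
    ultimately show ?thesis using DERIV_cong_ev by metis
  qed
  show ?thesis
    using opn[OF B] B hom der unfolding form_charts_golden_L h_def[symmetric] hB by auto
qed

text \<open>
  The vertical cylinders are the mirror images of the horizontal ones. Outside the open horizontal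
  cylinders there are, besides the vertex, only points in the interior of horizontal saddle connections,
  and these lie in open vertical cylinders. So the two families of parametrizations together reach every
  nonsingular point of the surface.
\<close>

definition vcyl :: "complex \<Rightarrow> complex set" where "vcyl z = mirror_map (hcyl (mirror z))"
definition vdom :: "complex set" where "vdom = {z. mirror z \<in> hdom}"

text \<open>
  Flat coordinates around a nonsingular point, in the form of a parametrization by displacement vectors
  from that point. Only the germ at 0 matters.
\<close>

definition flat_germ :: "(complex \<Rightarrow> complex set) \<Rightarrow> bool" where
  "flat_germ f \<longleftrightarrow> (\<exists>w\<in>hdom. \<forall>\<^sub>F d in nhds 0. f d = hcyl (w + d)) \<or>
     (\<exists>w\<in>vdom. \<forall>\<^sub>F d in nhds 0. f d = vcyl (w + d))"

lemma open_mirror_vimage: "open S \<Longrightarrow> open (mirror -` S)"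
  using continuous_on_mirror[OF continuous_on_id] by (intro open_vimage) auto

lemma mirror_in_interior: "z \<in> interior golden_polygon \<Longrightarrow> mirror z \<in> interior golden_polygon"
proof -
  assume z: "z \<in> interior golden_polygon"
  have "mirror -` interior golden_polygon \<subseteq> golden_polygon"
    using interior_subset mirror_in_golden_polygon by blast
  then have "mirror -` interior golden_polygon \<subseteq> interior golden_polygon"
    using open_mirror_vimage[OF open_interior] by (simp add: interior_maximal)
  then show ?thesis using z by (metis (no_types) subsetD mirror_simps(3) vimage_eq)
qed

lemma eventually_mirror: "\<forall>\<^sub>F d in nhds 0. P d \<Longrightarrow> \<forall>\<^sub>F d in nhds 0. P (mirror d)"
  using filterlim_mirror unfolding filterlim_iff by blast

lemma ball_in_hdom:
  assumes "w \<in> hdom" obtains r where "0 < r" "r \<le> 1/2" "ball w r \<subseteq> hdom"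
proof -
  obtain e where "0 < e" "ball w e \<subseteq> hdom" using open_hdom assms open_contains_ball by blast
  then show thesis by (intro that[of "min e (1/2)"]) auto
qed

lemma chart_of_flat_germ:
  assumes "flat_germ f"
  obtains U \<phi> c where "(U, \<phi>, \<lambda>_. 1) \<in> form_charts golden_L" "\<forall>\<^sub>F d in nhds 0. f d \<in> U \<and> \<phi> (f d) = c + d"
proof -
  note outer = that
  have *: thesis if 1: "(q ` B, inv_into B q, \<lambda>_. 1) \<in> form_charts golden_L" and 2: "inj_on q B" 
     and 3: "open B" "w \<in> B" and 4: "\<forall>\<^sub>F d in nhds 0. f d = q (w + d)" for q B w
  proof (rule outer[OF 1, of w])
    show "\<forall>\<^sub>F d in nhds 0. f d \<in> q ` B \<and> inv_into B q (f d) = w + d"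
      using eventually_translate[OF 3] 4 by eventually_elim (use 2 in auto)
  qed
  consider w where "w \<in> hdom" "\<forall>\<^sub>F d in nhds 0. f d = hcyl (w + d)"
    | w where "w \<in> vdom" "\<forall>\<^sub>F d in nhds 0. f d = vcyl (w + d)"
    using assms unfolding flat_germ_def by blast
  then show thesis
  proof cases
    case (1 w)
    obtain r where r: "0 < r" "r \<le> 1/2" "ball w r \<subseteq> hdom" using ball_in_hdom[OF 1(1)] by metis
    have inj: "inj_on hcyl (ball w r)"
      using r by (intro hcyl_inj_on_ball[where w = w]) (auto intro: subset_ball)
    show thesis
    proof (rule *[of hcyl "ball w r" w, OF chart_of_parametrization inj])
      show "continuous_map (top_of_set (ball w r)) GL hcyl"
        using r by (intro continuous_map_hcyl) auto
    qed (use r 1 inj openin_hcyl proj_eq_hcyl_locally in auto)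
  next
    case (2 w)
    have "mirror w \<in> hdom" using 2 by (simp add: vdom_def)
    then obtain r where r: "0 < r" "r \<le> 1/2" "ball (mirror w) r \<subseteq> hdom" by (rule ball_in_hdom)
    define B where "B = mirror -` ball (mirror w) r"
    have B: "open B" "w \<in> B" using r open_mirror_vimage[OF open_ball] by (simp_all add: B_def)
    have "inj_on hcyl (ball (mirror w) r)"
      using r by (intro hcyl_inj_on_ball[where w = "mirror w"]) (auto intro: subset_ball)
    then have inj: "inj_on vcyl B"
      by (intro inj_onI) (metis B_def inj_onD mirror_map_involution mirror_simps(3) vcyl_def vimage_eq)
    show thesis
    proof (rule *[of vcyl B w, OF chart_of_parametrization inj])
      have c1: "continuous_map (top_of_set (ball (mirror w) r)) GL hcyl"
        using r by (intro continuous_map_hcyl) auto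
      have c2: "continuous_map (top_of_set B) (top_of_set (ball (mirror w) r)) mirror"
        using continuous_on_mirror[OF continuous_on_id, of B] by (auto simp: B_def)
      have "continuous_map (top_of_set B) GL (mirror_map \<circ> (hcyl \<circ> mirror))"
        by (rule continuous_map_compose[OF continuous_map_compose[OF c2 c1] continuous_map_mirror_map])
      then show "continuous_map (top_of_set B) GL vcyl"
        by (simp add: vcyl_def[abs_def] comp_def)
    next
      fix W assume W: "open W" "W \<subseteq> B"
      have "vcyl ` W = mirror_map ` hcyl ` (mirror -` W)"
        by (force simp: vcyl_def image_iff intro: bexI[of _ "mirror _"])
      moreover have "mirror -` W \<subseteq> hdom" using W r by (force simp: B_def)
      ultimately show "openin GL (vcyl ` W)"
        using W by (simp add: openin_mirror_map openin_hcyl open_mirror_vimage)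
    next
      fix z u assume z: "z \<in> interior golden_polygon" and u: "u \<in> B" and eq: "proj z = vcyl u"
      have "proj (mirror z) = hcyl (mirror u)" using arg_cong[OF eq, of mirror_map] by (simp add: vcyl_def)
      moreover have "mirror u \<in> hdom" using u r by (auto simp: B_def)
      ultimately have "\<forall>\<^sub>F d in nhds 0. proj (mirror z + d) = hcyl (mirror u + d)"
        using z by (intro proj_eq_hcyl_locally mirror_in_interior) auto
      then have "\<forall>\<^sub>F d in nhds 0. proj (mirror z + mirror d) = hcyl (mirror u + mirror d)"
        by (rule eventually_mirror)
      then show "\<forall>\<^sub>F d in nhds 0. proj (z + d) = vcyl (u + d)"
      proof eventually_elim
        case (elim d)
        then show ?case using mirror_map_proj[of "mirror (z + d)"] by (simp add: vcyl_def mirror_add)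
      qed
    qed (use r 2 inj B in auto)
  qed
qed

lemma flat_germ_mirror:
  assumes "flat_germ f" shows "flat_germ (\<lambda>d. mirror_map (f (mirror d)))"
proof -
  consider w where "w \<in> hdom" "\<forall>\<^sub>F d in nhds 0. f d = hcyl (w + d)"
    | w where "w \<in> vdom" "\<forall>\<^sub>F d in nhds 0. f d = vcyl (w + d)"
    using assms unfolding flat_germ_def by blast
  then show ?thesis
  proof cases
    case (1 w)
    from eventually_mirror[OF this(2)] have "\<forall>\<^sub>F d in nhds 0. mirror_map (f (mirror d)) = vcyl (mirror w + d)"
      by eventually_elim (simp add: vcyl_def mirror_add)
    moreover have "mirror w \<in> vdom" using 1 by (simp add: vdom_def)
    ultimately show ?thesis unfolding flat_germ_def by blast
  next
    case (2 w)
    from eventually_mirror[OF this(2)] have "\<forall>\<^sub>F d in nhds 0. mirror_map (f (mirror d)) = hcyl (mirror w + d)"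
      by eventually_elim (simp add: vcyl_def mirror_add)
    moreover have "mirror w \<in> hdom" using 2 by (simp add: vdom_def)
    ultimately show ?thesis unfolding flat_germ_def by blast
  qed
qed

section \<open>The vertex is a zero of the form\<close>

text \<open>
  If \<open>f\<close> did not vanish at the vertex, a local primitive \<open>F\<close> of \<open>f(w) dw\<close> would be injective near it.
  But \<open>F\<close> pulls back to \<open>z\<close> plus a constant on each sector of the polygon at a vertex, and the sectors at
  the vertices 0 and 1 both contain the direction \<open>1 + \<i>\<close>. Points at the same small distance on these two
  rays would have the same image under \<open>F\<close>, although they are different points of the surface.
\<close>

lemma zero_of_form_at_vertex: "zero_of_form golden_L (proj 0)"
  unfolding zero_of_form_def
proof (intro conjI ballI impI; clarify?)
  have "0 \<in> golden_polygon" using gr_bounds by (auto simp: golden_polygon_def)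
  then show "proj 0 \<in> topspace (surface golden_L)" by (simp add: topspace_GL)
next
  fix U \<phi> f assume chart: "(U, \<phi>, f) \<in> form_charts golden_L" and U: "proj 0 \<in> U"
  note ch = chart[unfolded form_charts_golden_L]
  define w0 where "w0 = \<phi> (proj 0)"
  have op: "open (\<phi> ` U)" "w0 \<in> \<phi> ` U" using ch U by (auto simp: w0_def)
  show "f (\<phi> (proj 0)) = 0"
  proof (rule ccontr)
    assume "f (\<phi> (proj 0)) \<noteq> 0"
    then have nz: "f w0 \<noteq> 0" by (simp add: w0_def)
    obtain r0 where r0: "0 < r0" "ball w0 r0 \<subseteq> \<phi> ` U" using op open_contains_ball by blast
    have hol: "f holomorphic_on ball w0 r0" using ch r0 holomorphic_on_subset by blast
    obtain F where "\<And>x. x \<in> ball w0 r0 \<Longrightarrow> (F has_field_derivative f x) (at x within ball w0 r0)"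
      using holomorphic_convex_primitive'[OF convex_ball open_ball hol] by blast
    then have F: "(F has_field_derivative f x) (at x)" if "x \<in> ball w0 r0" for x
      using that at_within_open[OF that open_ball] by metis
    have holF: "F holomorphic_on ball w0 r0" using F by (metis holomorphic_on_open open_ball)
    have "deriv F w0 \<noteq> 0" using F[of w0] nz r0 by (simp add: DERIV_imp_deriv)
    then obtain r where r: "0 < r" "ball w0 r \<subseteq> ball w0 r0" "inj_on F (ball w0 r)"
      using has_complex_derivative_locally_injective[OF holF] r0 by (metis centre_in_ball open_ball)
    define V where "V = {x \<in> U. \<phi> x \<in> ball w0 r}"
    have cont\<phi>: "continuous_map (subtopology GL U) euclidean \<phi>"
      using ch homeomorphic_imp_continuous_map continuous_map_in_subtopology by blast
    have topU: "topspace (subtopology GL U) = U" using openin_subset[OF conjunct1[OF ch]] by (rule topspace_subtopology_subset)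
    have "openin (subtopology GL U) V"
      using openin_continuous_map_preimage[OF cont\<phi>, of "ball w0 r"] unfolding V_def topU by simp
    then have "openin GL V" using ch openin_trans_full by blast
    then obtain O' where O': "open O'" "{x \<in> golden_polygon. proj x \<in> V} = golden_polygon \<inter> O'"
      unfolding openin_GL by (auto simp: openin_open)
    define G where "G z = F (\<phi> (proj z))" for z
    \<comment> \<open>Along the diagonal ray from either vertex, \<open>G z - z\<close> is constant, with the same limit at the vertex.\<close>
    have key: "\<exists>e>0. \<forall>s\<in>{0<..<e}. proj (z0 + of_real s * Complex 1 1) \<in> V \<and> G (z0 + of_real s * Complex 1 1) = F w0 + of_real s * Complex 1 1"
      if z0: "proj z0 = proj 0" "z0 = 0 \<or> z0 = 1" for z0
    proof -
      have z0P: "z0 \<in> golden_polygon" using z0(2) gr_bounds by (auto simp: golden_polygon_def)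
      have "proj z0 \<in> V" using U r by (simp add: V_def z0 w0_def)
      then have "z0 \<in> O'" using O' z0P by blast
      then obtain e0 where e0: "0 < e0" "ball z0 e0 \<subseteq> O'" using O' open_contains_ball by blast
      define e where "e = min (e0 / 2) ((gr - 1) / 2)"
      have e: "0 < e" using e0 gr_bounds by (simp add: e_def)
      define ray where "ray s = z0 + of_real s * Complex 1 1" for s :: real
      have rayO: "ray s \<in> O'" if "0 \<le> s" "s \<le> e" for s
      proof -
        have "cmod (Complex 1 1) < 2" by (simp add: cmod_def real_sqrt_less_iff[of 2 4, simplified])
        have "cmod (of_real s * Complex 1 1) = s * cmod (Complex 1 1)"
          using that by (simp add: norm_mult)
        also have "\<dots> \<le> (e0 / 2) * cmod (Complex 1 1)" using that by (intro mult_right_mono) (auto simp: e_def)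
        also have "\<dots> < (e0 / 2) * 2" using \<open>cmod (Complex 1 1) < 2\<close> e0 by (intro mult_strict_left_mono) auto
        finally have "ray s \<in> ball z0 e0" by (simp add: ray_def dist_norm)
        then show ?thesis using e0 by blast
      qed
      have rayP: "ray s \<in> golden_polygon" if "0 \<le> s" "s \<le> e" for s
        using that z0(2) gr_bounds by (auto simp: ray_def golden_polygon_def e_def)
      have rayI: "ray s \<in> interior golden_polygon" if "0 < s" "s \<le> e" for s
      proof -
        have "open {z. 0 < Re z \<and> Re z < gr \<and> 0 < Im z \<and> Im z < 1}"
          by (intro open_Collect_conj open_Collect_less continuous_intros)
        moreover have "{z. 0 < Re z \<and> Re z < gr \<and> 0 < Im z \<and> Im z < 1} \<subseteq> golden_polygon"
          by (auto simp: golden_polygon_def)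
        moreover have "ray s \<in> {z. 0 < Re z \<and> Re z < gr \<and> 0 < Im z \<and> Im z < 1}"
          using that z0(2) gr_bounds by (auto simp: ray_def e_def)
        ultimately show ?thesis using interior_maximal by blast
      qed
      have rayV: "proj (ray s) \<in> V" if "0 \<le> s" "s \<le> e" for s
        using rayO[OF that] rayP[OF that] O' by blast
      have "continuous_map (top_of_set {0..e}) (subtopology GL U) (proj \<circ> ray)"
      proof -
        have "continuous_map (top_of_set {0..e}) (top_of_set golden_polygon) ray"
          using rayP by (auto simp: ray_def[abs_def] intro!: continuous_intros)
        then have "continuous_map (top_of_set {0..e}) GL (proj \<circ> ray)"
          using continuous_map_compose continuous_map_proj by blast
        then show ?thesis using rayV by (auto simp: continuous_map_in_subtopology V_def)
      qed
      then have "continuous_map (top_of_set {0..e}) euclidean (\<phi> \<circ> (proj \<circ> ray))"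
        using cont\<phi> continuous_map_compose by blast
      then have c1: "continuous_on {0..e} (\<lambda>s. \<phi> (proj (ray s)))" by (simp add: comp_def)
      have c2: "continuous_on (ball w0 r) F" using holF r holomorphic_on_imp_continuous_on continuous_on_subset by blast
      have "continuous_on {0..e} (\<lambda>s. G (ray s))"
        unfolding G_def by (rule continuous_on_compose2[OF c2 c1]) (use rayV in \<open>auto simp: V_def\<close>)
      then have cont: "continuous_on {0..e} (\<lambda>s. G (ray s) - of_real s * Complex 1 1)"
        by (intro continuous_intros)
      have "G (ray s) - of_real s * Complex 1 1 = F w0" if s: "s \<in> {0..e}" for s
      proof (rule has_derivative_zero_unique_strong_interval[OF _ cont _ _ s, of "{0}"])
        show "G (ray 0) - of_real 0 * Complex 1 1 = F w0" by (simp add: G_def ray_def z0 w0_def)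
        fix x assume x: "x \<in> {0..e} - {0}"
        obtain D where D: "((\<lambda>u. \<phi> (proj u)) has_field_derivative D) (at (ray x))" "f (\<phi> (proj (ray x))) * D = 1"
          using ch rayI[of x] rayV[of x] x by (auto simp: V_def)
        have "\<phi> (proj (ray x)) \<in> ball w0 r0" using rayV[of x] x r by (auto simp: V_def)
        from DERIV_chain2[OF F[OF this] D(1)] have "(G has_field_derivative 1) (at (ray x))"
          by (simp add: G_def[abs_def] D)
        moreover have "(ray has_vector_derivative Complex 1 1) (at x within {0..e})"
          unfolding ray_def[abs_def] by (auto intro!: derivative_eq_intros simp: of_real_def)
        ultimately have "(G \<circ> ray has_vector_derivative Complex 1 1 * 1) (at x within {0..e})"
          using field_vector_diff_chain_within has_field_derivative_at_within by blast
        then have "((\<lambda>s. G (ray s) - of_real s * Complex 1 1) has_vector_derivative 0) (at x within {0..e})"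
          by (auto intro!: derivative_eq_intros simp: comp_def of_real_def)
        then show "((\<lambda>s. G (ray s) - of_real s * Complex 1 1) has_derivative (\<lambda>h. 0)) (at x within {0..e})"
          by (simp add: has_vector_derivative_def)
      qed simp
      then show ?thesis
        using e rayV by (intro exI[of _ e]) (auto simp: ray_def algebra_simps)
    qed
    have p1: "proj 1 = proj 0" using proj_vertices by (simp add: one_complex.ctr)
    obtain e1 e2 where e: "0 < e1" "0 < e2"
      and V1: "\<And>s. s \<in> {0<..<e1} \<Longrightarrow> proj (0 + of_real s * Complex 1 1) \<in> V \<and> G (0 + of_real s * Complex 1 1) = F w0 + of_real s * Complex 1 1"
      and V2: "\<And>s. s \<in> {0<..<e2} \<Longrightarrow> proj (1 + of_real s * Complex 1 1) \<in> V \<and> G (1 + of_real s * Complex 1 1) = F w0 + of_real s * Complex 1 1"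
      using key[of 0] key[OF p1] by (metis (no_types))
    define s where "s = min (min (e1/2) (e2/2)) (1/2)"
    have s: "s \<in> {0<..<e1}" "s \<in> {0<..<e2}" "s < 1" using e by (auto simp: s_def)
    define a where "a = 0 + of_real s * Complex 1 1"
    define b where "b = 1 + of_real s * Complex 1 1"
    have "G a = G b" "proj a \<in> V" "proj b \<in> V" using V1[OF s(1)] V2[OF s(2)] by (simp_all add: a_def b_def)
    then have "\<phi> (proj a) = \<phi> (proj b)"
      using r(3) by (auto simp: G_def V_def inj_on_def)
    moreover have "inj_on \<phi> U" using ch homeomorphic_imp_injective_map topU by metis
    ultimately have "proj a = proj b" using \<open>proj a \<in> V\<close> \<open>proj b \<in> V\<close> by (auto simp: V_def inj_on_def)
    moreover have "b \<in> hdom" using s gr_bounds by (auto simp: b_def hdom_def)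
    ultimately obtain k where k: "b = a + of_real (circumference a * of_int k)"
      using proj_eq_in_hdom by blast
    have "Im a < 1" using s by (simp add: a_def)
    then have "Re b = Re a + gr * of_int k" using k by (simp add: circumference_def)
    then have "gr * of_int k = 1" by (simp add: a_def b_def)
    moreover have "gr * of_int k \<le> 0" if "k \<le> 0" using that gr_bounds by (simp add: mult_nonneg_nonpos)
    moreover have "gr * 1 \<le> gr * of_int k" if "1 \<le> k" using that gr_bounds by (intro mult_left_mono) auto
    ultimately show False using gr_bounds by linarith
  qed
qed

section \<open>Affine shears\<close>

definition shear :: "int \<Rightarrow> complex \<Rightarrow> complex" where
  "shear n v = Complex (Re v + of_int n * gr * Im v) (Im v)"

lemma shear_simps [simp]: "Re (shear n v) = Re v + of_int n * gr * Im v" "Im (shear n v) = Im v" "shear n 0 = 0"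
  by (simp_all add: shear_def complex_eq_iff)

lemma shear_scaleR: "shear n (r *\<^sub>R v) = r *\<^sub>R shear n v"
  by (simp add: complex_eq_iff algebra_simps)

lemma shear_uminus [simp]: "shear n (shear (- n) v) = v"
  by (simp add: complex_eq_iff algebra_simps)

lemma eventually_shear: 
  assumes "\<forall>\<^sub>F d in nhds 0. P d" shows "\<forall>\<^sub>F d in nhds 0. P (shear n d)"
proof -
  have "continuous_on UNIV (shear n)" unfolding shear_def Complex_eq by (intro continuous_intros)
  then have "isCont (shear n) 0" by (simp add: continuous_on_eq_continuous_at)
  then have "filterlim (shear n) (nhds 0) (nhds 0)"
    using tendsto_at_iff_tendsto_nhds[of "shear n" 0] by (simp add: isCont_def)
  then show ?thesis using assms unfolding filterlim_iff by blast
qed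

text \<open>
  The shear of the two horizontal cylinders, on representatives in the polygon. The upper cylinder is
  sheared relative to its own bottom edge at height 1. Since its height is \<open>g - 1 = 1 / g\<close>, its top edge
  is moved by \<open>n\<close> full turns, just as the top edge of the lower cylinder, and horizontal edges are fixed.
\<close>

definition shear_rep :: "int \<Rightarrow> complex \<Rightarrow> complex set" where
  "shear_rep n z = (if Im z \<le> 1 then hstrip gr (z + of_real (of_int n * gr * Im z))
     else hstrip 1 (z + of_real (of_int n * gr * (Im z - 1))))"

definition shear_map :: "int \<Rightarrow> complex set \<Rightarrow> complex set" where
  "shear_map n C = shear_rep n (SOME z. proj z = C)"

lemma shear_rep_bottom_edge: "Im z = 0 \<Longrightarrow> shear_rep n z = hstrip gr z"
  by (simp add: shear_rep_def)

lemma shear_rep_middle: "Im z = 1 \<Longrightarrow> shear_rep n z = hstrip gr z"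
  using hstrip_shift[of gr z n] gr_bounds by (simp add: shear_rep_def mult.commute)

lemma shear_rep_top_edge: 
  assumes "Im z = gr" shows "shear_rep n z = hstrip 1 z"
proof -
  have e: "of_int n * gr * (gr - 1) = 1 * of_int n" using gr_square by algebra
  have "shear_rep n z = hstrip 1 (z + of_real (of_int n * gr * (gr - 1)))"
    using assms gr_bounds by (simp add: shear_rep_def)
  also have "\<dots> = hstrip 1 z" unfolding e by (rule hstrip_shift) simp
  finally show ?thesis .
qed

lemma shear_map_proj: "shear_map n (proj z) = shear_rep n z"
proof -
  have "shear_rep n z = shear_rep n z'" if g: "(z, z') \<in> glue_rel golden_gluings" for z z'
  proof -
    have e: "proj z = proj z'" using g by (rule proj_step)
    consider (1) "Im z = 0" "0 \<le> Re z" "Re z \<le> 1" "z' = z + Complex 0 gr"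
      | (2) "Im z = 0" "1 \<le> Re z" "Re z \<le> gr" "z' = z + Complex 0 1"
      | (3) "Re z = 0" "0 \<le> Im z" "Im z \<le> 1" "z' = z + Complex gr 0"
      | (4) "Re z = 0" "1 \<le> Im z" "Im z \<le> gr" "z' = z + Complex 1 0"
      using g unfolding glue_rel_golden by blast
    then show ?thesis
    proof cases
      case 1
      then have "hstrip gr z = proj z" using gr_bounds
        by (intro hstrip_bottom_eq_proj) (auto simp: golden_polygon_def)
      moreover have "hstrip 1 z' = proj z'" using 1 gr_bounds
        by (intro hstrip_top_eq_proj) (auto simp: golden_polygon_def)
      ultimately show ?thesis using 1 e by (simp add: shear_rep_bottom_edge shear_rep_top_edge)
    next
      case 2
      then have "hstrip gr z = proj z" "hstrip gr z' = proj z'" using gr_bounds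
        by (auto intro!: hstrip_bottom_eq_proj simp: golden_polygon_def)
      then show ?thesis using 2 e by (simp add: shear_rep_bottom_edge shear_rep_middle)
    next
      case 3
      define u where "u = z + of_real (of_int n * gr * Im z)"
      have "z' + of_real (of_int n * gr * Im z) = u + of_real (gr * of_int 1)" using 3 by (simp add: u_def complex_eq_iff)
      then have "hstrip gr (z' + of_real (of_int n * gr * Im z)) = hstrip gr u" using hstrip_shift[of gr u 1] gr_bounds by simp
      then show ?thesis using 3 by (simp add: shear_rep_def u_def)
    next
      case 4
      show ?thesis
      proof (cases "Im z = 1")
        case True
        have "hstrip gr z = proj z" "hstrip gr z' = proj z'" using gr_bounds True 4
          by (auto intro!: hstrip_bottom_eq_proj simp: golden_polygon_def)
        then show ?thesis using 4 True e by (simp add: shear_rep_middle)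
      next
        case False
        define u where "u = z + of_real (of_int n * gr * (Im z - 1))"
        have "z' + of_real (of_int n * gr * (Im z - 1)) = u + of_real (1 * of_int 1)" using 4 by (simp add: u_def complex_eq_iff)
        then have "hstrip 1 (z' + of_real (of_int n * gr * (Im z - 1))) = hstrip 1 u" using hstrip_shift[of 1 u 1] by simp
        then show ?thesis using 4 False by (simp add: shear_rep_def u_def)
      qed
    qed
  qed
  moreover have "proj (SOME z'. proj z' = proj z) = proj z" by (rule someI[of _ z]) simp
  ultimately show ?thesis unfolding shear_map_def by (rule proj_invariant)
qed

text \<open>
  The two formulas live on the closed bottom rectangle and on the closed rectangle above it. They agree on
  the common edge; to the right of it, at height 1, only the first one makes sense.
\<close>

lemma continuous_map_shear_map: "continuous_map GL GL (shear_map n)"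
proof -
  have "continuous_map (top_of_set golden_polygon) GL (shear_rep n)"
  proof (rule pasting_lemma_closed[where I = UNIV
        and T = "\<lambda>b. if b then {z \<in> golden_polygon. Im z \<le> 1} else {z \<in> golden_polygon. 1 \<le> Im z \<and> Re z \<le> 1}"
        and f = "\<lambda>b z. if b then hstrip gr (z + of_real (of_int n * gr * Im z))
                  else hstrip 1 (z + of_real (of_int n * gr * (Im z - 1)))"])
    show "finite (UNIV :: bool set)" by simp
  next
    fix b :: bool
    have "closed {z. Im z \<le> 1}" "closed {z. 1 \<le> Im z \<and> Re z \<le> 1}"
      by (intro closed_Collect_conj closed_Collect_le continuous_intros)+
    then show "closedin (top_of_set golden_polygon) (if b then {z \<in> golden_polygon. Im z \<le> 1} else {z \<in> golden_polygon. 1 \<le> Im z \<and> Re z \<le> 1})"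
      using closedin_closed_Int[of "{z. Im z \<le> 1}" golden_polygon]
        closedin_closed_Int[of "{z. 1 \<le> Im z \<and> Re z \<le> 1}" golden_polygon]
      by (simp add: Int_def)
    have c: "continuous_map (top_of_set {z \<in> golden_polygon. Im z \<le> 1}) (top_of_set {z. 0 \<le> Im z \<and> Im z \<le> 1}) 
        (\<lambda>z. z + of_real (of_int n * gr * Im z))"
      by (auto simp: golden_polygon_def intro!: continuous_intros)
    have c': "continuous_map (top_of_set {z \<in> golden_polygon. 1 \<le> Im z \<and> Re z \<le> 1}) (top_of_set {z. 1 \<le> Im z \<and> Im z \<le> gr}) 
        (\<lambda>z. z + of_real (of_int n * gr * (Im z - 1)))"
      using gr_bounds by (auto simp: golden_polygon_def intro!: continuous_intros)
    show "continuous_map (subtopology (top_of_set golden_polygon)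
        (if b then {z \<in> golden_polygon. Im z \<le> 1} else {z \<in> golden_polygon. 1 \<le> Im z \<and> Re z \<le> 1})) GL
       (\<lambda>z. if b then hstrip gr (z + of_real (of_int n * gr * Im z)) else hstrip 1 (z + of_real (of_int n * gr * (Im z - 1))))"
      using continuous_map_compose[OF c continuous_map_hstrip_bottom] continuous_map_compose[OF c' continuous_map_hstrip_top]
      by (simp add: comp_def subtopology_subtopology Int_absorb1[OF Collect_subset[of golden_polygon]])
  next
    have *: "hstrip gr (z + of_real (of_int n * gr * Im z)) = hstrip 1 (z + of_real (of_int n * gr * (Im z - 1)))"
      if z: "z \<in> golden_polygon" "Im z = 1" "Re z \<le> 1" for z
      using z hstrip_top_eq_proj[of z] hstrip_bottom_eq_proj[of z] shear_rep_middle[of z n] by (simp add: shear_rep_def)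
    fix b b' :: bool and z
    assume "z \<in> topspace (top_of_set golden_polygon) \<inter> 
      (if b then {z \<in> golden_polygon. Im z \<le> 1} else {z \<in> golden_polygon. 1 \<le> Im z \<and> Re z \<le> 1}) \<inter>
      (if b' then {z \<in> golden_polygon. Im z \<le> 1} else {z \<in> golden_polygon. 1 \<le> Im z \<and> Re z \<le> 1})"
    then show "(if b then hstrip gr (z + of_real (of_int n * gr * Im z)) else hstrip 1 (z + of_real (of_int n * gr * (Im z - 1)))) =
      (if b' then hstrip gr (z + of_real (of_int n * gr * Im z)) else hstrip 1 (z + of_real (of_int n * gr * (Im z - 1))))"
      using *[of z] by (cases b; cases b') auto
  next
    fix z assume "z \<in> topspace (top_of_set golden_polygon)"
    then show "\<exists>b. b \<in> UNIV \<and> z \<in> (if b then {z \<in> golden_polygon. Im z \<le> 1} else {z \<in> golden_polygon. 1 \<le> Im z \<and> Re z \<le> 1}) \<and>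
      shear_rep n z = (if b then hstrip gr (z + of_real (of_int n * gr * Im z)) else hstrip 1 (z + of_real (of_int n * gr * (Im z - 1))))"
      by (intro exI[of _ "Im z \<le> 1"]) (auto simp: shear_rep_def golden_polygon_def)
  qed
  moreover have "shear_rep n = shear_map n \<circ> proj" by (auto simp: shear_map_proj)
  ultimately show ?thesis
    using continuous_compose_quotient_map_eq[OF quotient_map_proj] by metis
qed

lemma vcyl_eq_proj:
  assumes "z \<in> golden_polygon" "Re z \<noteq> 1" shows "vcyl z = proj z"
  using assms by (simp add: vcyl_def hcyl_eq_proj mirror_in_golden_polygon)

lemma vcyl_shift: "vcyl (z + Complex 0 (circumference (mirror z) * of_int k)) = vcyl z"
proof -
  have "mirror (z + Complex 0 (circumference (mirror z) * of_int k)) = mirror z + of_real (circumference (mirror z) * of_int k)"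
    by (simp add: complex_eq_iff)
  then show ?thesis by (simp only: vcyl_def hcyl_shift)
qed

lemma vcyl_representative:
  assumes "w \<in> vdom"
  obtains u where "u \<in> vdom" "0 \<le> Im u" "Im u < circumference (mirror u)" "\<forall>\<^sub>F d in nhds 0. vcyl (w + d) = vcyl (u + d)"
proof -
  define k where "k = \<lfloor>Im w / circumference (mirror w)\<rfloor>"
  define u where "u = w - Complex 0 (circumference (mirror w) * of_int k)"
  have "of_int k \<le> Im w / circumference (mirror w)" "Im w / circumference (mirror w) < of_int k + 1" unfolding k_def by linarith+
  then have "circumference (mirror w) * of_int k \<le> Im w" "Im w < circumference (mirror w) * of_int k + circumference (mirror w)"
    using circumference_pos(1)[of "mirror w"]
    by (simp_all only: pos_le_divide_eq pos_divide_less_eq ring_distribs mult.commute mult_1)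
  moreover have c: "circumference (mirror u) = circumference (mirror w)" by (rule circumference_cong) (simp add: u_def)
  ultimately have "0 \<le> Im u" "Im u < circumference (mirror u)" unfolding c by (auto simp: u_def)
  moreover have "u \<in> vdom" using assms by (auto simp: vdom_def hdom_def u_def)
  moreover have "\<forall>\<^sub>F d in nhds 0. u + d \<in> (if Re u < 1 then {z. Re z < 1} else {z. 1 < Re z})"
    using \<open>u \<in> vdom\<close> by (intro eventually_translate) (auto simp: vdom_def hdom_def intro!: open_Collect_less continuous_intros)
  then have "\<forall>\<^sub>F d in nhds 0. vcyl (w + d) = vcyl (u + d)"
  proof eventually_elim
    case (elim d)
    then have "circumference (mirror (u + d)) = circumference (mirror w)"
      unfolding c[symmetric] by (auto simp: circumference_def split: if_splits)
    then have "w + d = (u + d) + Complex 0 (circumference (mirror (u + d)) * of_int k)" by (simp add: u_def)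
    then show ?case by (simp only: vcyl_shift)
  qed
  ultimately show thesis by (intro that[of u])
qed

lemma shear_map_hcyl_bottom:
  assumes "w \<in> hdom" "Im w < 1" shows "shear_map n (hcyl w) = hcyl (shear n w)"
proof -
  obtain k u where u: "hcyl w = proj u" "w = u + of_real (circumference w * of_int k)"
    using hcyl_representative[OF assms(1)] by metis
  have c: "circumference w = gr" "circumference (shear n w) = gr" using assms by (simp_all add: circumference_def)
  have Im: "Im u = Im w" using u(2) by (metis Im_complex_of_real add.right_neutral plus_complex.sel(2))
  have e: "shear n w = (u + of_real (of_int n * gr * Im u)) + of_real (gr * of_int k)"
    using arg_cong[OF u(2), of Re] Im c by (simp add: complex_eq_iff)
  have "hcyl (shear n w) = hstrip gr (shear n w)" by (simp add: hcyl_def c)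
  also have "\<dots> = hstrip gr (u + of_real (of_int n * gr * Im u))"
    unfolding e using gr_bounds by (intro hstrip_shift) simp
  finally show ?thesis using assms Im by (simp add: u(1) shear_map_proj shear_rep_def)
qed

lemma shear_map_hcyl_top:
  assumes "w \<in> hdom" "1 < Im w" shows "shear_map n (hcyl w) = hcyl (shear n w - of_real (of_int n * gr))"
proof -
  obtain k u where u: "hcyl w = proj u" "w = u + of_real (circumference w * of_int k)"
    using hcyl_representative[OF assms(1)] by metis
  have c: "circumference w = 1" "circumference (shear n w - of_real (of_int n * gr)) = 1" using assms by (simp_all add: circumference_def)
  have Im: "Im u = Im w" using u(2) by (metis Im_complex_of_real add.right_neutral plus_complex.sel(2))
  have e: "shear n w - of_real (of_int n * gr) = (u + of_real (of_int n * gr * (Im u - 1))) + of_real (1 * of_int k)"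
    using arg_cong[OF u(2), of Re] Im c by (simp add: complex_eq_iff algebra_simps)
  have "hcyl (shear n w - of_real (of_int n * gr)) = hstrip 1 (shear n w - of_real (of_int n * gr))"
    by (simp only: hcyl_def c)
  also have "\<dots> = hstrip 1 (u + of_real (of_int n * gr * (Im u - 1)))"
    unfolding e by (rule hstrip_shift) simp
  finally show ?thesis using assms Im by (simp add: u(1) shear_map_proj shear_rep_def)
qed

text \<open>
  Inside a horizontal cylinder the affine map is literally a shear in the cylinder coordinates.
\<close>

lemma flat_germ_shear_hcyl:
  assumes "w \<in> hdom"
  obtains w' where "w' \<in> hdom" "\<forall>\<^sub>F d in nhds 0. shear_map n (hcyl (w + d)) = hcyl (w' + shear n d)"
proof (cases "Im w < 1")
  case True
  have "\<forall>\<^sub>F d in nhds 0. w + d \<in> hdom \<inter> {z. Im z < 1}"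
    using assms True by (intro eventually_translate open_Int open_hdom) (auto intro!: open_Collect_less continuous_intros)
  then have "\<forall>\<^sub>F d in nhds 0. shear_map n (hcyl (w + d)) = hcyl (shear n w + shear n d)"
  proof eventually_elim
    case (elim d)
    have "shear n (w + d) = shear n w + shear n d" by (simp add: complex_eq_iff algebra_simps)
    then show ?case using elim by (simp add: shear_map_hcyl_bottom)
  qed
  moreover have "shear n w \<in> hdom" using assms by (simp add: hdom_def)
  ultimately show thesis using that by blast
next
  case False
  then have "1 < Im w" using assms by (auto simp: hdom_def)
  then have "\<forall>\<^sub>F d in nhds 0. w + d \<in> hdom \<inter> {z. 1 < Im z}"
    using assms by (intro eventually_translate open_Int open_hdom) (auto intro!: open_Collect_less continuous_intros)
  then have "\<forall>\<^sub>F d in nhds 0. shear_map n (hcyl (w + d)) = hcyl (shear n w - of_real (of_int n * gr) + shear n d)"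
  proof eventually_elim
    case (elim d)
    have "shear n (w + d) - of_real (of_int n * gr) = shear n w - of_real (of_int n * gr) + shear n d" by (simp add: complex_eq_iff algebra_simps)
    then show ?case using elim shear_map_hcyl_top[of "w + d" n] by (simp only: Int_iff mem_Collect_eq)
  qed
  moreover have "shear n w - of_real (of_int n * gr) \<in> hdom" using assms by (simp add: hdom_def)
  ultimately show thesis using that by blast
qed

lemma eventually_translate_shear:
  assumes "open S" "z \<in> S" shows "\<forall>\<^sub>F d in nhds 0. z + d \<in> S \<and> z + shear n d \<in> S"
  using eventually_translate[OF assms] eventually_shear[OF eventually_translate[OF assms]] by (rule eventually_conj)

text \<open>
  In a vertical cylinder there are three kinds of points. Inside the polygon at a height other than 1,
  horizontal coordinates are available as well. On the segment at height 1, a fixed point of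
  the map, the formulas for the two rectangles combine into one shear, because they differ by
  \<open>n\<close> full turns of the lower cylinder. The same happens on the horizontal edges glued to height 0, where the
  cylinder that ends there from below is the upper or the lower one depending on the real part.
\<close>

lemma flat_germ_shear_vcyl:
  assumes w: "w \<in> vdom" and Im: "0 \<le> Im w" "Im w < circumference (mirror w)"
  shows "(\<exists>w'\<in>hdom. \<forall>\<^sub>F d in nhds 0. shear_map n (vcyl (w + d)) = hcyl (w' + shear n d)) \<or>
     (\<forall>\<^sub>F d in nhds 0. shear_map n (vcyl (w + d)) = vcyl (w + shear n d))"
proof -
  have Re: "0 < Re w" "Re w < gr" "Re w \<noteq> 1" using w by (auto simp: vdom_def hdom_def)
  have "Re w < 1" if "Im w = 1" using Im Re that by (auto simp: circumference_def split: if_splits)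
  then consider (edge) "Im w = 0" | (middle) "Im w = 1" "Re w < 1" | (inner) "0 < Im w" "Im w \<noteq> 1" 
    using Im by linarith
  then show ?thesis
  proof cases
    case inner
    define S where "S = {z. 0 < Re z \<and> Re z < gr \<and> Re z \<noteq> 1 \<and> 0 < Im z \<and> Im z < gr \<and> Im z \<noteq> 1 \<and> (Re z < 1 \<or> Im z < 1)}"
    have "open S" unfolding S_def
      by (intro open_Collect_conj open_Collect_disj open_Collect_less open_Collect_neq continuous_intros)
    moreover have "w \<in> S" using inner Re Im by (auto simp: S_def circumference_def split: if_splits)
    ultimately have "\<forall>\<^sub>F d in nhds 0. w + d \<in> S" by (rule eventually_translate)
    then have 1: "\<forall>\<^sub>F d in nhds 0. vcyl (w + d) = hcyl (w + d)"
    proof eventually_elim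
      case (elim d)
      then have "w + d \<in> golden_polygon" "Re (w + d) \<noteq> 1" "Im (w + d) \<noteq> 1" by (auto simp: S_def golden_polygon_def)
      then show ?case using vcyl_eq_proj hcyl_eq_proj by metis
    qed
    have "w \<in> hdom" using \<open>w \<in> S\<close> by (auto simp: S_def hdom_def)
    then obtain w' where w': "w' \<in> hdom" "\<forall>\<^sub>F d in nhds 0. shear_map n (hcyl (w + d)) = hcyl (w' + shear n d)"
      by (rule flat_germ_shear_hcyl)
    from 1 w'(2) have "\<forall>\<^sub>F d in nhds 0. shear_map n (vcyl (w + d)) = hcyl (w' + shear n d)"
      by eventually_elim simp
    then show ?thesis using w'(1) by blast
  next
    case middle
    define S where "S = {z. 0 < Re z \<and> Re z < 1 \<and> 0 < Im z \<and> Im z < gr}"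
    have "open S" unfolding S_def
      by (intro open_Collect_conj open_Collect_less continuous_intros)
    moreover have "w \<in> S" using middle Re gr_bounds by (auto simp: S_def)
    ultimately have "\<forall>\<^sub>F d in nhds 0. w + d \<in> S \<and> w + shear n d \<in> S" by (rule eventually_translate_shear)
    then have "\<forall>\<^sub>F d in nhds 0. shear_map n (vcyl (w + d)) = vcyl (w + shear n d)"
    proof eventually_elim
      case (elim d)
      define u where "u = w + d"
      define u' where "u' = w + shear n d"
      have P: "u \<in> golden_polygon" "u' \<in> golden_polygon" "Re u \<noteq> 1" "Re u' \<noteq> 1" "Re u' \<le> 1" and Im_eq: "Im u' = Im u"
        using elim by (auto simp: u_def u'_def S_def golden_polygon_def)
      have u': "u' = u + of_real (of_int n * gr * (Im u - 1))" using middle by (simp add: u_def u'_def complex_eq_iff)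
      have "shear_map n (vcyl u) = shear_rep n u" using P by (simp add: vcyl_eq_proj shear_map_proj)
      also have "\<dots> = proj u'"
      proof (cases "Im u \<le> 1")
        case True
        have "u + of_real (of_int n * gr * Im u) = u' + of_real (gr * of_int n)" by (simp add: u' complex_eq_iff algebra_simps)
        then have "shear_rep n u = hstrip gr u'" using True hstrip_shift[of gr u' n] gr_bounds by (simp add: shear_rep_def)
        then show ?thesis using True P Im_eq by (simp add: hstrip_bottom_eq_proj)
      next
        case False
        then have "shear_rep n u = hstrip 1 u'" by (simp add: shear_rep_def u')
        then show ?thesis using False P Im_eq by (simp add: hstrip_top_eq_proj)
      qed
      also have "\<dots> = vcyl u'" using P by (simp add: vcyl_eq_proj)
      finally show ?case by (simp add: u_def u'_def)
    qed
    then show ?thesis by blast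
  next
    case edge
    \<comment> \<open>The bound \<open>\<epsilon>\<close> is the height of the horizontal cylinder that ends at this edge from below.\<close>
    define \<epsilon> where "\<epsilon> = (if Re w < 1 then gr - 1 else 1)"
    define S where "S = {z. 0 < Re z \<and> Re z < gr \<and> -\<epsilon> < Im z \<and> Im z < 1} \<inter> (if Re w < 1 then {z. Re z < 1} else {z. 1 < Re z})"
    have "open S" unfolding S_def
      by (auto intro!: open_Int open_Collect_conj open_Collect_less continuous_intros)
    moreover have "w \<in> S" using edge Re gr_bounds by (auto simp: S_def \<epsilon>_def)
    ultimately have "\<forall>\<^sub>F d in nhds 0. w + d \<in> S \<and> w + shear n d \<in> S" by (rule eventually_translate_shear)
    then have "\<forall>\<^sub>F d in nhds 0. shear_map n (vcyl (w + d)) = vcyl (w + shear n d)"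
    proof eventually_elim
      case (elim d)
      define u where "u = w + d"
      define u' where "u' = w + shear n d"
      have uS: "u \<in> S" "u' \<in> S" using elim by (simp_all add: u_def u'_def)
      have Im_eq: "Im u' = Im u" by (simp add: u_def u'_def)
      have u': "u' = u + of_real (of_int n * gr * Im u)" using edge by (simp add: u_def u'_def complex_eq_iff)
      have ne: "Re u \<noteq> 1" "Re u' \<noteq> 1" using uS by (auto simp: S_def split: if_splits)
      have "shear_map n (vcyl u) = vcyl u'"
      proof (cases "0 \<le> Im u")
        case True
        then have P: "u \<in> golden_polygon" "u' \<in> golden_polygon" "Im u \<le> 1" using uS Im_eq by (auto simp: S_def golden_polygon_def)
        then have "shear_map n (vcyl u) = hstrip gr u'" using ne by (simp add: vcyl_eq_proj shear_map_proj shear_rep_def u')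
        then show ?thesis using P ne Im_eq by (simp add: hstrip_bottom_eq_proj vcyl_eq_proj)
      next
        case False
        define l where "l = circumference (mirror w)"
        have l: "circumference (mirror u) = l" "circumference (mirror u') = l"
          using uS by (auto simp: l_def circumference_def S_def split: if_splits)
        define v where "v = u + Complex 0 l"
        define v' where "v' = u' + Complex 0 l"
        have vu: "vcyl u = vcyl v" "vcyl u' = vcyl v'"
          using vcyl_shift[of u 1] vcyl_shift[of u' 1] by (simp_all add: v_def v'_def l)
        have P: "v \<in> golden_polygon" "v' \<in> golden_polygon" "Re v \<noteq> 1" "Re v' \<noteq> 1"
          using uS False Im_eq gr_bounds ne
          by (auto simp: v_def v'_def S_def golden_polygon_def l_def circumference_def \<epsilon>_def split: if_splits)
        have "shear_map n (vcyl u) = shear_rep n v" using P by (simp add: vu vcyl_eq_proj shear_map_proj)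
        also have "\<dots> = proj v'"
        proof (cases "Re w < 1")
          case True
          then have lg: "l = gr" by (simp add: l_def circumference_def)
          have Im: "1 < Im v" "Im v' = Im v" "Re v' \<le> 1" using uS True Im_eq by (auto simp: v_def v'_def S_def \<epsilon>_def lg)
          have "of_int n * gr * (gr - 1) = (of_int n :: real)" using gr_square by algebra
          then have "v + of_real (of_int n * gr * (Im v - 1)) = v' + of_real (1 * of_int n)"
            by (simp add: v_def v'_def u' lg complex_eq_iff algebra_simps)
          then have "shear_rep n v = hstrip 1 v'" using Im hstrip_shift[of 1 v' n] by (simp add: shear_rep_def)
          then show ?thesis using P Im by (simp add: hstrip_top_eq_proj)
        next
          case F: False
          then have lg: "l = 1" by (simp add: l_def circumference_def)
          have Im: "Im v \<le> 1" "Im v' = Im v" using False Im_eq by (auto simp: v_def v'_def lg)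
          have "v + of_real (of_int n * gr * Im v) = v' + of_real (gr * of_int n)"
            by (simp add: v_def v'_def u' lg complex_eq_iff algebra_simps)
          then have "shear_rep n v = hstrip gr v'" using Im hstrip_shift[of gr v' n] gr_bounds by (simp add: shear_rep_def)
          then show ?thesis using P Im by (simp add: hstrip_bottom_eq_proj)
        qed
        also have "\<dots> = vcyl u'" using P by (simp add: vu vcyl_eq_proj)
        finally show ?thesis .
      qed
      then show ?case by (simp add: u_def u'_def)
    qed
    then show ?thesis by blast
  qed
qed

lemma flat_germ_shear:
  assumes "flat_germ f" shows "flat_germ (\<lambda>d. shear_map n (f (shear (- n) d)))"
proof -
  consider w where "w \<in> hdom" "\<forall>\<^sub>F d in nhds 0. f d = hcyl (w + d)"
    | w where "w \<in> vdom" "\<forall>\<^sub>F d in nhds 0. f d = vcyl (w + d)"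
    using assms unfolding flat_germ_def by blast
  then consider w' where "w' \<in> hdom" "\<forall>\<^sub>F d in nhds 0. shear_map n (f d) = hcyl (w' + shear n d)"
    | w' where "w' \<in> vdom" "\<forall>\<^sub>F d in nhds 0. shear_map n (f d) = vcyl (w' + shear n d)"
  proof cases
    case (1 w)
    obtain w' where w': "w' \<in> hdom" "\<forall>\<^sub>F d in nhds 0. shear_map n (hcyl (w + d)) = hcyl (w' + shear n d)"
      using 1(1) by (rule flat_germ_shear_hcyl)
    from 1(2) w'(2) have "\<forall>\<^sub>F d in nhds 0. shear_map n (f d) = hcyl (w' + shear n d)"
      by eventually_elim simp
    then show ?thesis using that(1) w'(1) by blast
  next
    case (2 w)
    obtain u where u: "u \<in> vdom" "0 \<le> Im u" "Im u < circumference (mirror u)" "\<forall>\<^sub>F d in nhds 0. vcyl (w + d) = vcyl (u + d)"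
      using 2(1) by (rule vcyl_representative)
    have fu: "\<forall>\<^sub>F d in nhds 0. f d = vcyl (u + d)" using 2(2) u(4) by eventually_elim simp
    from flat_germ_shear_vcyl[OF u(1-3), of n] show ?thesis
    proof (elim disjE bexE)
      fix w' assume w': "w' \<in> hdom" "\<forall>\<^sub>F d in nhds 0. shear_map n (vcyl (u + d)) = hcyl (w' + shear n d)"
      from fu w'(2) have "\<forall>\<^sub>F d in nhds 0. shear_map n (f d) = hcyl (w' + shear n d)" by eventually_elim simp
      then show ?thesis using that(1) w'(1) by blast
    next
      assume "\<forall>\<^sub>F d in nhds 0. shear_map n (vcyl (u + d)) = vcyl (u + shear n d)"
      with fu have "\<forall>\<^sub>F d in nhds 0. shear_map n (f d) = vcyl (u + shear n d)" by eventually_elim simp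
      then show ?thesis using that(2) u(1) by blast
    qed
  qed
  then show ?thesis
  proof cases
    case (1 w')
    then show ?thesis using eventually_shear[OF 1(2), of "- n"] unfolding flat_germ_def by auto
  next
    case (2 w')
    then show ?thesis using eventually_shear[OF 2(2), of "- n"] unfolding flat_germ_def by auto
  qed
qed

section \<open>The action on saddle connections\<close>

definition straight_at :: "(real \<Rightarrow> complex set) \<Rightarrow> complex \<Rightarrow> real \<Rightarrow> bool" where
  "straight_at \<gamma> v t \<longleftrightarrow> (\<exists>f. flat_germ f \<and> (\<forall>\<^sub>F s in nhds t. \<gamma> s = f ((s - t) *\<^sub>R v)))"

text \<open>
  Saddle connections, phrased through flat germs instead of holomorphic charts, because affine maps
  transport the former but not the latter.
\<close>

definition flat_saddle :: "complex \<Rightarrow> bool" where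
  "flat_saddle v \<longleftrightarrow> v \<noteq> 0 \<and> (\<exists>\<gamma>. pathin GL \<gamma> \<and> \<gamma> 0 = proj 0 \<and> \<gamma> 1 = proj 0 \<and> (\<forall>t\<in>{0<..<1}. straight_at \<gamma> v t))"

lemma saddle_period_if_flat_saddle:
  assumes "flat_saddle v" shows "v \<in> saddle_periods golden_L"
proof -
  obtain \<gamma> where v: "v \<noteq> 0" and \<gamma>: "pathin GL \<gamma>" "\<gamma> 0 = proj 0" "\<gamma> 1 = proj 0"
    and st: "\<And>t. t \<in> {0<..<1} \<Longrightarrow> straight_at \<gamma> v t"
    using assms unfolding flat_saddle_def by blast
  have inner: "form_along golden_L \<gamma> t v \<and> \<not> zero_of_form golden_L (\<gamma> t)" if t: "t \<in> {0<..<1}" for t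
  proof -
    obtain f where f: "flat_germ f" "\<forall>\<^sub>F s in nhds t. \<gamma> s = f ((s - t) *\<^sub>R v)"
      using st[OF t] unfolding straight_at_def by blast
    obtain U \<phi> c where ch: "(U, \<phi>, \<lambda>_. 1) \<in> form_charts golden_L" "\<forall>\<^sub>F d in nhds 0. f d \<in> U \<and> \<phi> (f d) = c + d"
      using f(1) by (rule chart_of_flat_germ)
    have "((\<lambda>s. (s - t) *\<^sub>R v) \<longlongrightarrow> (t - t) *\<^sub>R v) (nhds t)" by (intro tendsto_intros filterlim_ident)
    then have "filterlim (\<lambda>s. (s - t) *\<^sub>R v) (nhds 0) (nhds t)" by simp
    then have "\<forall>\<^sub>F s in nhds t. f ((s - t) *\<^sub>R v) \<in> U \<and> \<phi> (f ((s - t) *\<^sub>R v)) = c + (s - t) *\<^sub>R v"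
      using ch(2) unfolding filterlim_iff by blast
    with f(2) have ev: "\<forall>\<^sub>F s in nhds t. \<gamma> s \<in> U \<and> \<phi> (\<gamma> s) = c + (s - t) *\<^sub>R v"
      by eventually_elim simp
    then have U: "\<gamma> t \<in> U" using eventually_nhds_x_imp_x[OF ev] by simp
    have "((\<lambda>s. c + (s - t) *\<^sub>R v) has_vector_derivative v) (at t)"
      by (auto intro!: derivative_eq_intros)
    moreover obtain S where "open S" "t \<in> S" "\<And>s. s \<in> S \<Longrightarrow> \<phi> (\<gamma> s) = c + (s - t) *\<^sub>R v"
      using ev unfolding eventually_nhds by blast
    ultimately have "((\<lambda>s. \<phi> (\<gamma> s)) has_vector_derivative v) (at t)"
      using has_vector_derivative_transform_within_open[of "\<lambda>s. c + (s - t) *\<^sub>R v" v t S "\<lambda>s. \<phi> (\<gamma> s)"] by simp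
    then have "form_along golden_L \<gamma> t v"
      unfolding form_along_def using ch(1) U by (intro bexI[of _ "(U, \<phi>, \<lambda>_. 1)"]) auto
    moreover have "\<not> zero_of_form golden_L (\<gamma> t)"
      using ch(1) U unfolding zero_of_form_def by fastforce
    ultimately show ?thesis by blast
  qed
  have "saddle_connection golden_L \<gamma>"
    using v \<gamma> zero_of_form_at_vertex inner unfolding saddle_connection_def by auto
  moreover have "has_period golden_L \<gamma> v"
    using has_integral_const_real[of v 0 1] inner
    unfolding has_period_def by (intro exI[of _ "\<lambda>_. v"]) auto
  ultimately show ?thesis unfolding saddle_periods_def by blast
qed

lemma flat_saddle_shear:
  assumes "flat_saddle v" shows "flat_saddle (shear n v)"
proof -
  obtain \<gamma> where v: "v \<noteq> 0" and \<gamma>: "pathin GL \<gamma>" "\<gamma> 0 = proj 0" "\<gamma> 1 = proj 0"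
    and st: "\<And>t. t \<in> {0<..<1} \<Longrightarrow> straight_at \<gamma> v t"
    using assms unfolding flat_saddle_def by blast
  have "shear n v \<noteq> 0" using v by (auto simp: complex_eq_iff)
  moreover have "pathin GL (shear_map n \<circ> \<gamma>)"
    using \<gamma>(1) continuous_map_shear_map unfolding pathin_def by (rule continuous_map_compose)
  moreover have "shear_map n (proj 0) = proj 0"
    using gr_bounds by (simp add: shear_map_proj shear_rep_bottom_edge hstrip_bottom_eq_proj golden_polygon_def)
  moreover have "straight_at (shear_map n \<circ> \<gamma>) (shear n v) t" if t: "t \<in> {0<..<1}" for t
  proof -
    obtain f where f: "flat_germ f" "\<forall>\<^sub>F s in nhds t. \<gamma> s = f ((s - t) *\<^sub>R v)"
      using st[OF t] unfolding straight_at_def by blast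
    have inv: "shear (- n) (shear n v) = v" using shear_uminus[of "- n" v] by simp
    from f(2) have "\<forall>\<^sub>F s in nhds t. (shear_map n \<circ> \<gamma>) s = shear_map n (f (shear (- n) ((s - t) *\<^sub>R shear n v)))"
      by eventually_elim (simp add: shear_scaleR inv)
    then show ?thesis using flat_germ_shear[OF f(1), of n] unfolding straight_at_def by blast
  qed
  ultimately show ?thesis using \<gamma> unfolding flat_saddle_def by (intro conjI exI[of _ "shear_map n \<circ> \<gamma>"]) auto
qed

lemma flat_saddle_mirror:
  assumes "flat_saddle v" shows "flat_saddle (mirror v)"
proof -
  obtain \<gamma> where v: "v \<noteq> 0" and \<gamma>: "pathin GL \<gamma>" "\<gamma> 0 = proj 0" "\<gamma> 1 = proj 0"
    and st: "\<And>t. t \<in> {0<..<1} \<Longrightarrow> straight_at \<gamma> v t"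
    using assms unfolding flat_saddle_def by blast
  have "mirror v \<noteq> 0" using v by (auto simp: complex_eq_iff)
  moreover have "pathin GL (mirror_map \<circ> \<gamma>)"
    using \<gamma>(1) continuous_map_mirror_map unfolding pathin_def by (rule continuous_map_compose)
  moreover have "straight_at (mirror_map \<circ> \<gamma>) (mirror v) t" if t: "t \<in> {0<..<1}" for t
  proof -
    obtain f where f: "flat_germ f" "\<forall>\<^sub>F s in nhds t. \<gamma> s = f ((s - t) *\<^sub>R v)"
      using st[OF t] unfolding straight_at_def by blast
    have "\<forall>\<^sub>F s in nhds t. (mirror_map \<circ> \<gamma>) s = mirror_map (f (mirror ((s - t) *\<^sub>R mirror v)))"
      using f(2) by eventually_elim (simp add: mirror_scaleR)
    then show ?thesis using flat_germ_mirror[OF f(1)] unfolding straight_at_def by blast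
  qed
  ultimately show ?thesis using \<gamma> unfolding flat_saddle_def by (intro conjI exI[of _ "mirror_map \<circ> \<gamma>"]) auto
qed

text \<open>
  The bottom edge from 1 to \<open>g\<close> lies in the vertical cylinder of circumference 1.
\<close>

lemma flat_saddle_base: "flat_saddle (Complex (gr - 1) 0)"
  unfolding flat_saddle_def
proof (intro conjI exI ballI)
  define \<gamma> where "\<gamma> = (\<lambda>t::real. proj (Complex (1 + t * (gr - 1)) 0))"
  have P: "Complex (1 + t * (gr - 1)) 0 \<in> golden_polygon" if "0 \<le> t" "t \<le> 1" for t
  proof -
    have "0 \<le> t * (gr - 1)" "t * (gr - 1) \<le> 1 * (gr - 1)"
      using that gr_bounds by (auto intro!: mult_right_mono)
    then show ?thesis by (auto simp: golden_polygon_def)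
  qed
  have "continuous_map (top_of_set {0..1}) (top_of_set golden_polygon) (\<lambda>t::real. Complex (1 + t * (gr - 1)) 0)"
    using P by (auto simp: Complex_eq intro!: continuous_intros)
  from continuous_map_compose[OF this continuous_map_proj] show "pathin GL \<gamma>"
    by (simp add: pathin_def \<gamma>_def comp_def)
  show "\<gamma> 0 = proj 0" "\<gamma> 1 = proj 0" by (simp_all add: \<gamma>_def proj_vertices)
  show "Complex (gr - 1) 0 \<noteq> 0" using gr_bounds by (simp add: complex_eq_iff)
  fix t :: real assume t: "t \<in> {0<..<1}"
  define w where "w = Complex (1 + t * (gr - 1)) 0"
  have "0 < t * (gr - 1)" "t * (gr - 1) < 1 * (gr - 1)" using t gr_bounds by (auto intro: mult_strict_right_mono)
  then have "w \<in> vdom" using t by (simp add: w_def vdom_def hdom_def)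
  then have germ: "flat_germ (\<lambda>d. vcyl (w + d))" unfolding flat_germ_def by (intro disjI2 bexI[of _ w]) auto
  have "\<forall>\<^sub>F s in nhds t. s \<in> {0<..<1}" using t by (intro eventually_nhds_in_open) auto
  then have "\<forall>\<^sub>F s in nhds t. \<gamma> s = vcyl (w + (s - t) *\<^sub>R Complex (gr - 1) 0)"
  proof eventually_elim
    case (elim s)
    have "w + (s - t) *\<^sub>R Complex (gr - 1) 0 = Complex (1 + s * (gr - 1)) 0"
      by (simp add: w_def complex_eq_iff algebra_simps)
    moreover have "0 < s * (gr - 1)" using elim gr_bounds by simp
    ultimately show ?case using P[of s] elim gr_bounds by (simp add: \<gamma>_def vcyl_eq_proj)
  qed
  then show "straight_at \<gamma> (Complex (gr - 1) 0) t" using germ unfolding straight_at_def by blast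
qed

section \<open>Arithmetic in the ring of golden integers\<close>

lemma gr_upper: "gr < 17/10"
proof -
  have "sqrt 5 < 12/5" by (rule real_less_lsqrt) (simp_all add: power2_eq_square)
  then show ?thesis by (simp add: golden_ratio_def)
qed

lemma gr_irrational: "gr \<notin> \<rat>"
proof
  assume "gr \<in> \<rat>"
  then obtain a b where ab: "gr = of_int a / of_int b" "b > 0" "coprime a b" by (rule Rats_cases')
  have "of_int (a * a) = (of_int (b * (a + b)) :: real)"
  proof -
    have "of_int a = gr * of_int b" unfolding ab(1) using ab(2) by simp
    then show ?thesis unfolding of_int_mult of_int_add using gr_square by algebra
  qed
  then have eq: "a * a = b * (a + b)" by (rule of_int_eq_iff[THEN iffD1])
  then have "b dvd a * a" by simp
  then have "b dvd 1" using ab(3) by (metis coprime_commute coprime_dvd_mult_left_iff coprime_common_divisor dvd_refl)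
  then have "b = 1" using ab(2) by simp
  then have "a * (a - 1) = 1" using eq by (simp add: algebra_simps)
  then have "a = 1 \<or> a = -1" using zmult_eq_1_iff by blast
  then show False using \<open>a * (a - 1) = 1\<close> by auto
qed

definition Zgr :: "real set" where "Zgr = {of_int x + of_int y * gr | x y. True}"

lemma ZgrI: "of_int x + of_int y * gr \<in> Zgr" by (auto simp: Zgr_def)

lemma Zgr_of_int [simp]: "of_int x \<in> Zgr" using ZgrI[of x 0] by simp

lemma Zgr_of_nat [simp]: "of_nat n \<in> Zgr" using Zgr_of_int[of "int n"] by simp

lemma Zgr_gr [simp]: "gr \<in> Zgr" using ZgrI[of 0 1] by simp

lemma Zgr_0_1 [simp]: "0 \<in> Zgr" "1 \<in> Zgr" using Zgr_of_int[of 0] Zgr_of_int[of 1] by simp_all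

lemma Zgr_numeral [simp]: "numeral k \<in> Zgr" using Zgr_of_int[of "numeral k"] by simp

lemma Zgr_add [intro, simp]: "x \<in> Zgr \<Longrightarrow> y \<in> Zgr \<Longrightarrow> x + y \<in> Zgr"
proof -
  assume "x \<in> Zgr" "y \<in> Zgr"
  then obtain a b c d where "x = of_int a + of_int b * gr" "y = of_int c + of_int d * gr" by (auto simp: Zgr_def)
  then have "x + y = of_int (a + c) + of_int (b + d) * gr" by (simp add: algebra_simps)
  then show ?thesis by (metis ZgrI)
qed

lemma Zgr_mult [intro, simp]: "x \<in> Zgr \<Longrightarrow> y \<in> Zgr \<Longrightarrow> x * y \<in> Zgr"
proof -
  assume "x \<in> Zgr" "y \<in> Zgr"
  then obtain a b c d where "x = of_int a + of_int b * gr" "y = of_int c + of_int d * gr" by (auto simp: Zgr_def)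
  then have "x * y = of_int a * of_int c + (of_int a * of_int d + of_int b * of_int c) * gr + of_int b * of_int d * (gr * gr)" by (simp add: algebra_simps)
  then have "x * y = of_int (a * c + b * d) + of_int (a * d + b * c + b * d) * gr" unfolding gr_square by (simp add: algebra_simps)
  then show ?thesis by (metis ZgrI)
qed

lemma Zgr_uminus [intro, simp]: "x \<in> Zgr \<Longrightarrow> - x \<in> Zgr"
  using Zgr_mult[OF Zgr_of_int[of "-1"]] by fastforce

lemma Zgr_diff [intro, simp]: "x \<in> Zgr \<Longrightarrow> y \<in> Zgr \<Longrightarrow> x - y \<in> Zgr"
  using Zgr_add[of x "- y"] by simp

lemma Zgr_power [intro, simp]: "x \<in> Zgr \<Longrightarrow> x ^ n \<in> Zgr"
  by (induction n) auto

definition comaximal :: "real \<Rightarrow> real \<Rightarrow> bool" where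
  "comaximal x y \<longleftrightarrow> (\<exists>u\<in>Zgr. \<exists>v\<in>Zgr. u * x + v * y = 1)"

text \<open>
  One half of the Chinese remainder theorem: an element that is 1 modulo \<open>x\<close> and 0 modulo each \<open>y j\<close>,
  obtained as the product of such elements for the single \<open>j\<close>.
\<close>

lemma comaximal_idempotent:
  assumes "finite J" "\<And>j. j \<in> J \<Longrightarrow> comaximal x (y j)" "x \<in> Zgr" "\<And>j. j \<in> J \<Longrightarrow> y j \<in> Zgr"
  shows "\<exists>v\<in>Zgr. \<forall>j\<in>J. \<exists>z\<in>Zgr. 1 - v * x = z * y j"
  using assms
proof (induction J rule: finite_induct)
  case empty
  then show ?case by (intro bexI[of _ 0]) auto
next
  case (insert i J)
  then obtain v where v: "v \<in> Zgr" "\<And>j. j \<in> J \<Longrightarrow> \<exists>z\<in>Zgr. 1 - v * x = z * y j" by auto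
  obtain a b where ab: "a \<in> Zgr" "b \<in> Zgr" "a * x + b * y i = 1" using insert.prems(1)[of i] by (auto simp: comaximal_def)
  have by_: "b * y i = 1 - a * x" using ab(3) by simp
  define v' where "v' = v + a - v * a * x"
  have eq: "1 - v' * x = (1 - v * x) * (b * y i)" unfolding by_ by (simp add: v'_def algebra_simps)
  have "v' \<in> Zgr" using v ab insert.prems(2) by (simp add: v'_def)
  moreover have "\<exists>z\<in>Zgr. 1 - v' * x = z * y j" if "j \<in> insert i J" for j
  proof (cases "j = i")
    case True
    then show ?thesis using v(1) ab insert.prems(2) by (intro bexI[of _ "(1 - v * x) * b"]) (auto simp: eq)
  next
    case False
    then have "j \<in> J" using that by simp
    then obtain z where "z \<in> Zgr" "1 - v * x = z * y j" using v(2) by metis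
    then show ?thesis using ab insert.prems by (intro bexI[of _ "z * (b * y i)"]) (auto simp: eq)
  qed
  ultimately show ?case by blast
qed

text \<open>
  The multiplier \<open>N j\<close> kills integers modulo \<open>N\<close> and sends \<open>g\<close> to 1 modulo \<open>N\<close>, approximately.
\<close>

lemma near_lattice_multiplier:
  fixes N :: int and \<epsilon> :: real
  assumes "N > 0" "\<epsilon> > 0"
  obtains j l :: int where "\<bar>of_int N * of_int j * gr - 1 - of_int N * of_int l\<bar> < \<epsilon>"
proof -
  obtain h k where "\<bar>of_int k * gr - of_int h - 1 / of_int N\<bar> < \<epsilon> / of_int N"
    using sequence_of_fractional_parts_is_dense[OF gr_irrational, of "\<epsilon> / of_int N"] assms by (metis divide_pos_pos of_int_0_less_iff)
  then have "of_int N * \<bar>of_int k * gr - of_int h - 1 / of_int N\<bar> < \<epsilon>" using assms by (simp add: field_simps)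
  also have "of_int N * \<bar>of_int k * gr - of_int h - 1 / of_int N\<bar> = \<bar>of_int N * (of_int k * gr - of_int h - 1 / of_int N)\<bar>"
    using assms by (simp add: abs_mult)
  also have "of_int N * (of_int k * gr - of_int h - 1 / of_int N) = of_int N * of_int k * gr - 1 - of_int N * (of_int h :: real)"
    using assms by (simp add: field_simps)
  finally show thesis by (rule that)
qed

text \<open>
  The coordinates refer to the basis \<open>1\<close>, \<open>g\<^sup>2 = g + 1\<close>. The conjugate of \<open>g\<^sup>2\<close> is \<open>1 / g\<^sup>2 = 2 - g\<close>.
\<close>

definition golden_int :: "int \<Rightarrow> int \<Rightarrow> real" where "golden_int A B = of_int A + of_int B * (gr + 1)"
definition golden_conj :: "int \<Rightarrow> int \<Rightarrow> real" where "golden_conj A B = of_int A + of_int B * (2 - gr)"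
definition golden_norm :: "int \<Rightarrow> int \<Rightarrow> int" where "golden_norm A B = A * A + 3 * A * B + B * B"

lemma golden_int_times_conj: "golden_int A B * golden_conj A B = of_int (golden_norm A B)"
proof -
  have "(gr + 1) * (2 - gr) = 1" using gr_square by algebra
  then show ?thesis unfolding golden_int_def golden_conj_def golden_norm_def by (simp; algebra)
qed

lemma golden_int_in_Zgr [simp]: "golden_int A B \<in> Zgr" "golden_conj A B \<in> Zgr"
  by (simp_all add: golden_int_def golden_conj_def)

text \<open>
  After multiplication by the unit \<open>g\<^sup>2\<close> the conjugate has \<open>g\<close>-coefficient \<open>A\<close>, which is the small one
  of the two coordinates in the application. This coefficient is the resolution with which residues
  modulo the norm can be prescribed.
\<close>

lemma golden_conj_shift: "(gr + 1) * golden_conj A B = of_int (A + B) + of_int A * gr"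
proof -
  have "(gr + 1) * (2 - gr) = 1" using gr_square by algebra
  then show ?thesis unfolding golden_conj_def by (simp; algebra)
qed

section \<open>Simultaneous approximation\<close>

text \<open>
  The key step. Dividing by the step \<open>g \<beta>\<^sub>i\<close>, one needs a real number \<open>t / g\<close> whose quotient by \<open>\<beta>\<^sub>i\<close>
  is within \<open>1 / (2 g \<beta>\<^sub>i)\<close> of \<open>a\<^sub>i / (g \<beta>\<^sub>i)\<close> modulo 1. The candidates are the multiples \<open>\<tau> \<Lambda>\<close> of elements
  \<open>\<Lambda>\<close> of \<open>\<int>[g]\<close>, whose quotients by \<open>\<beta>\<^sub>i\<close> are close to \<open>Y\<^sub>i / N\<^sub>i\<close> modulo 1. The assumption on \<open>B\<close>
  makes the conjugate of \<open>\<beta>\<^sub>i\<close> at least \<open>12 A\<^sub>i\<close>, so that fractions with numerators divisible by \<open>A\<^sub>i\<close> and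
  denominator \<open>N\<^sub>i\<close> are dense enough.
\<close>

lemma progressions_meet_in_unit_interval:
  fixes A B :: "nat \<Rightarrow> int" and a :: "nat \<Rightarrow> real"
  assumes A: "\<And>i. i < K \<Longrightarrow> 1 \<le> A i" and B: "\<And>i. i < K \<Longrightarrow> 40 * A i \<le> B i"
    and co: "\<And>i j. i < K \<Longrightarrow> j < K \<Longrightarrow> i \<noteq> j \<Longrightarrow> comaximal (golden_int (A i) (B i)) (golden_int (A j) (B j))"
  shows "\<exists>t n. \<forall>i<K. \<bar>a i + of_int (n i) * gr * golden_int (A i) (B i) - t\<bar> < 1/2"
proof -
  define \<beta> where "\<beta> i = golden_int (A i) (B i)" for i
  define \<beta>c where "\<beta>c i = golden_conj (A i) (B i)" for i
  define N where "N i = golden_norm (A i) (B i)" for i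
  have pos: "0 < A i" "0 < B i" "0 < N i" "0 < \<beta> i" "12 * of_int (A i) \<le> \<beta>c i" if "i < K" for i
  proof -
    show 1: "0 < A i" "0 < B i" using A[OF that] B[OF that] by auto
    show "0 < N i" using 1 by (simp add: N_def golden_norm_def add_pos_pos)
    show "0 < \<beta> i" using 1 gr_bounds by (simp add: \<beta>_def golden_int_def add_pos_pos)
    have "12 * of_int (A i) \<le> of_int (B i) * (3/10 :: real)" using B[OF that] by linarith
    also have "\<dots> \<le> of_int (B i) * (2 - gr)" using 1 gr_upper by (intro mult_left_mono) auto
    also have "\<dots> \<le> \<beta>c i" using 1 by (simp add: \<beta>c_def golden_conj_def)
    finally show "12 * of_int (A i) \<le> \<beta>c i" .
  qed
  have \<beta>N: "\<beta> i * \<beta>c i = of_int (N i)" for i by (simp add: \<beta>_def \<beta>c_def N_def golden_int_times_conj)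
  have inv\<beta>: "1 / \<beta> i = \<beta>c i / of_int (N i)" if "i < K" for i
    using \<beta>N[of i] pos[OF that] by (simp add: field_simps)
  \<comment> \<open>Dual elements: \<open>e k\<close> contributes to the \<open>g\<close>-coefficients the residue \<open>A k\<close> modulo \<open>N k\<close>, and 0 modulo the other norms.\<close>
  define D where "D k i = (if i = k then A k else 0)" for k i
  have "\<exists>e. \<forall>i<K. \<exists>X y. e * \<beta>c i = of_int X + of_int (D k i + N i * y) * gr" if k: "k < K" for k
  proof -
    obtain v where v: "v \<in> Zgr" "\<And>j. j \<in> {..<K} - {k} \<Longrightarrow> \<exists>z\<in>Zgr. 1 - v * \<beta> k = z * \<beta> j"
      using comaximal_idempotent[of "{..<K} - {k}" "\<beta> k" \<beta>] co[OF k] by (auto simp: \<beta>_def)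
    define e where "e = (gr + 1) * (1 - v * \<beta> k)"
    have "\<exists>X y. e * \<beta>c i = of_int X + of_int (D k i + N i * y) * gr" if i: "i < K" for i
    proof (cases "i = k")
      case True
      have "(gr + 1) * v \<in> Zgr" using v(1) by simp
      then obtain x y where xy: "(gr + 1) * v = of_int x + of_int y * gr" by (auto simp: Zgr_def)
      have "e * \<beta>c k = (gr + 1) * \<beta>c k - (gr + 1) * v * (\<beta> k * \<beta>c k)" by (simp add: e_def algebra_simps)
      also have "\<dots> = of_int (A k + B k - x * N k) + of_int (A k + N k * (- y)) * gr"
        unfolding \<beta>N xy unfolding \<beta>c_def golden_conj_shift by (simp add: algebra_simps)
      finally show ?thesis unfolding True D_def by (metis (full_types))
    next
      case False
      then obtain z where z: "z \<in> Zgr" "1 - v * \<beta> k = z * \<beta> i" using v(2)[of i] i by auto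
      have "(gr + 1) * z \<in> Zgr" using z(1) by simp
      then obtain x y where xy: "(gr + 1) * z = of_int x + of_int y * gr" by (auto simp: Zgr_def)
      have "e * \<beta>c i = (gr + 1) * z * (\<beta> i * \<beta>c i)" by (simp add: e_def z(2) algebra_simps)
      also have "\<dots> = of_int (N i * x) + of_int (D k i + N i * y) * gr"
        unfolding \<beta>N xy using False by (simp add: D_def algebra_simps)
      finally show ?thesis by blast
    qed
    then show ?thesis by blast
  qed
  then obtain e X y where e: "\<And>k i. k < K \<Longrightarrow> i < K \<Longrightarrow> e k * \<beta>c i = of_int (X k i) + of_int (D k i + N i * y k i) * gr"
    by metis
  \<comment> \<open>\<open>r i * A i / N i\<close> approximates the target \<open>a i / (g \<beta>\<^sub>i)\<close> from below.\<close>
  define r where "r i = \<lfloor>a i * of_int (N i) / (gr * \<beta> i * of_int (A i))\<rfloor>" for i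
  define \<Lambda> where "\<Lambda> = (\<Sum>k<K. of_int (r k) * e k)"
  define X' where "X' i = (\<Sum>k<K. r k * X k i)" for i
  define y' where "y' i = (\<Sum>k<K. r k * y k i)" for i
  define Y where "Y i = r i * A i + N i * y' i" for i
  have \<Lambda>: "\<Lambda> * \<beta>c i = of_int (X' i) + of_int (Y i) * gr" if i: "i < K" for i
  proof -
    have "\<Lambda> * \<beta>c i = (\<Sum>k<K. of_int (r k) * (of_int (X k i) + of_int (D k i + N i * y k i) * gr))"
      unfolding \<Lambda>_def sum_distrib_right using i by (intro sum.cong) (auto simp: e mult.assoc)
    also have "\<dots> = of_int (\<Sum>k<K. r k * X k i) + of_int (\<Sum>k<K. r k * (D k i + N i * y k i)) * gr"
      by (simp add: sum_distrib_left sum_distrib_right sum.distrib algebra_simps)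
    also have "(\<Sum>k<K. r k * (D k i + N i * y k i)) = (\<Sum>k<K. if k = i then r k * A k else 0) + N i * (\<Sum>k<K. r k * y k i)"
      unfolding sum_distrib_left sum.distrib[symmetric] by (intro sum.cong) (auto simp: D_def algebra_simps)
    also have "\<dots> = Y i" using i by (simp add: Y_def y'_def)
    finally show ?thesis by (simp add: X'_def)
  qed
  define NN where "NN = (\<Prod>i<K. N i)"
  have NN: "NN > 0" unfolding NN_def by (intro prod_pos) (use pos in auto)
  define \<epsilon> where "\<epsilon> = 1 / (8 * (1 + (\<Sum>i<K. \<beta> i)))"
  \<comment> \<open>A common bound for the factors by which the error of the multiplier is amplified.\<close>
  define S where "S = 1 + (\<Sum>i<K. \<bar>Y i\<bar>)"
  have S: "1 \<le> S" "\<bar>Y i\<bar> \<le> S" if "i < K" for i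
    using member_le_sum[of i "{..<K}" "\<lambda>i. \<bar>Y i\<bar>"] that by (auto simp: S_def sum_nonneg)
  have S0: "0 < S" unfolding S_def by (simp add: add_pos_nonneg sum_nonneg)
  have sum\<beta>: "0 \<le> (\<Sum>i<K. \<beta> i)" by (intro sum_nonneg) (use pos in \<open>auto intro: less_imp_le\<close>)
  have \<epsilon>: "0 < \<epsilon>" unfolding \<epsilon>_def using sum\<beta> by simp
  have \<epsilon>\<beta>: "gr * \<beta> i * \<epsilon> \<le> 1/4" if "i < K" for i
  proof -
    have "\<beta> i \<le> (\<Sum>i<K. \<beta> i)" using that pos by (intro member_le_sum) (auto intro: less_imp_le)
    then have "\<beta> i * \<epsilon> \<le> 1/8" unfolding \<epsilon>_def using sum\<beta> by (simp add: field_simps)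
    then have "gr * (\<beta> i * \<epsilon>) \<le> 2 * (1/8)" using gr_bounds pos(4)[OF that] \<epsilon> by (intro mult_mono) auto
    then show ?thesis by (simp add: mult.assoc)
  qed
  have "0 < \<epsilon> / of_int S" using \<epsilon> S0 by simp
  with NN obtain j l :: int where jl: "\<bar>of_int NN * of_int j * gr - 1 - of_int NN * of_int l\<bar> < \<epsilon> / of_int S"
    by (rule near_lattice_multiplier)
  define \<delta> where "\<delta> = of_int NN * of_int j * gr - 1 - of_int NN * of_int l"
  define t where "t = gr * (of_int NN * of_int j * \<Lambda>)"
  define N' where "N' i = NN div N i" for i
  define n where "n i = N' i * j * X' i + Y i * N' i * l + y' i" for i
  have "\<bar>a i + of_int (n i) * gr * \<beta> i - t\<bar> < 1/2" if i: "i < K" for i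
  proof -
    note p = pos[OF i]
    have "NN = N i * N' i" unfolding N'_def NN_def using i by (simp add: dvd_mult_div_cancel dvd_prodI)
    then have NN': "of_int NN = of_int (N i) * (of_int (N' i) :: real)" by simp
    have \<beta>c: "\<beta> i * \<beta>c i = of_int (N i)" by (rule \<beta>N)
    have "of_int (N i) * (of_int NN * of_int j * \<Lambda>) = \<beta> i * (of_int NN * of_int j * (\<Lambda> * \<beta>c i))"
      unfolding \<beta>c[symmetric] by (simp add: algebra_simps)
    also have "of_int NN * of_int j * (\<Lambda> * \<beta>c i) = of_int NN * of_int j * of_int (X' i) + of_int (Y i) * (of_int NN * of_int j * gr)"
      unfolding \<Lambda>[OF i] by (simp add: algebra_simps)
    also have "of_int NN * of_int j * gr = 1 + of_int NN * of_int l + \<delta>" by (simp add: \<delta>_def)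
    also have "of_int NN * of_int j * of_int (X' i) + of_int (Y i) * (1 + of_int NN * of_int l + \<delta>) =
       of_int (N i) * of_int (n i) + of_int (r i) * of_int (A i) + of_int (Y i) * \<delta>"
      unfolding NN' by (simp add: n_def Y_def algebra_simps)
    finally have key: "of_int NN * of_int j * \<Lambda> = \<beta> i * (of_int (n i) + of_int (r i) * of_int (A i) / of_int (N i) + of_int (Y i) * \<delta> / of_int (N i))"
      using p(3) by (simp add: field_simps)
    define q where "q = a i * of_int (N i) / (gr * \<beta> i * of_int (A i))"
    have ai: "a i = gr * \<beta> i * (q * (of_int (A i) / of_int (N i)))"
      using p gr_bounds by (simp add: q_def)
    have "a i + of_int (n i) * gr * \<beta> i - t = gr * \<beta> i * ((q - of_int (r i)) * (of_int (A i) / of_int (N i))) - gr * \<beta> i * (of_int (Y i) * \<delta> / of_int (N i))"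
      unfolding t_def key ai by (simp add: algebra_simps add_divide_distrib diff_divide_distrib)
    moreover have "\<bar>gr * \<beta> i * ((q - of_int (r i)) * (of_int (A i) / of_int (N i)))\<bar> < 1/4"
    proof -
      have q: "0 \<le> q - of_int (r i)" "q - of_int (r i) \<le> 1" unfolding r_def q_def[symmetric] by linarith+
      have "gr * \<beta> i * ((q - of_int (r i)) * (of_int (A i) / of_int (N i))) = gr * ((q - of_int (r i)) * (of_int (A i) / \<beta>c i))"
        unfolding \<beta>c[symmetric] using p(4) by simp
      moreover have "0 < \<beta>c i" using p by (smt (verit) of_int_0_less_iff)
      then have "of_int (A i) / \<beta>c i \<le> 1/12" "0 \<le> of_int (A i) / \<beta>c i" using p by (simp_all add: field_simps)
      then have "(q - of_int (r i)) * (of_int (A i) / \<beta>c i) \<le> 1 * (1/12)" "0 \<le> (q - of_int (r i)) * (of_int (A i) / \<beta>c i)"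
        using q by (intro mult_mono mult_nonneg_nonneg; simp)+
      moreover have "\<bar>gr * x\<bar> < 1/4" if "0 \<le> x" "x \<le> 1/12" for x
        using mult_right_mono[OF less_imp_le[OF gr_bounds(2)] that(1)] that gr_bounds by (simp add: abs_mult)
      ultimately show ?thesis by (metis mult_1)
    qed
    moreover have "\<bar>gr * \<beta> i * (of_int (Y i) * \<delta> / of_int (N i))\<bar> \<le> 1/4"
    proof -
      have "\<bar>of_int (Y i) * \<delta> / of_int (N i)\<bar> = \<bar>of_int (Y i)\<bar> * \<bar>\<delta>\<bar> / of_int (N i)"
        using p by (simp add: abs_mult)
      also have "\<dots> \<le> \<bar>of_int (Y i)\<bar> * \<bar>\<delta>\<bar> / 1" using p by (intro divide_left_mono) auto
      also have "\<dots> \<le> of_int S * (\<epsilon> / of_int S)"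
        using S(2)[OF i] jl S0 unfolding \<delta>_def[symmetric] div_by_1 by (intro mult_mono) (auto simp flip: of_int_abs)
      also have "\<dots> = \<epsilon>" using S0 by simp
      finally have "gr * \<beta> i * \<bar>of_int (Y i) * \<delta> / of_int (N i)\<bar> \<le> gr * \<beta> i * \<epsilon>"
        using p gr_bounds by (intro mult_left_mono) auto
      moreover have "\<bar>gr * \<beta> i * (of_int (Y i) * \<delta> / of_int (N i))\<bar> = gr * \<beta> i * \<bar>of_int (Y i) * \<delta> / of_int (N i)\<bar>"
        using p gr_bounds by (simp add: abs_mult)
      ultimately show ?thesis using \<epsilon>\<beta>[OF i] by (metis order_trans)
    qed
    moreover have "\<bar>x - y\<bar> < 1/2" if "\<bar>x\<bar> < 1/4" "\<bar>y\<bar> \<le> 1/4" for x y :: real using that by linarith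
    ultimately show ?thesis by metis
  qed
  then show ?thesis unfolding \<beta>_def by blast
qed

section \<open>Close heights\<close>

text \<open>
  Powers of the unit \<open>2 - g = 1 / g\<^sup>2\<close>; their coordinates in the basis \<open>1\<close>, \<open>- g\<^sup>2\<close> are Fibonacci numbers.
\<close>

lemma small_unit:
  fixes \<epsilon> :: real assumes "\<epsilon> > 0"
  obtains F G :: int and u' where "0 < F" "0 \<le> G" "0 < of_int F - of_int G * (gr + 1)" "of_int F - of_int G * (gr + 1) < \<epsilon>"
    "u' \<in> Zgr" "(of_int F - of_int G * (gr + 1)) * u' = 1"
proof -
  have inv: "(2 - gr) * (gr + 1) = 1" using gr_square by algebra
  have "\<exists>F G :: int. 0 < F \<and> 0 \<le> G \<and> G < F \<and> (2 - gr) ^ k = of_int F - of_int G * (gr + 1)" for k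
  proof (induction k)
    case 0
    show ?case by (intro exI[of _ 1] exI[of _ 0]) simp
  next
    case (Suc k)
    then obtain F G :: int where FG: "0 < F" "0 \<le> G" "G < F" "(2 - gr) ^ k = of_int F - of_int G * (gr + 1)" by auto
    have "(2 - gr) ^ Suc k = (2 - gr) * of_int F - of_int G" unfolding power_Suc FG(4) using inv by algebra
    also have "\<dots> = of_int (3 * F - G) - of_int F * (gr + 1)" by (simp add: algebra_simps)
    finally show ?case using FG by (intro exI[of _ "3 * F - G"] exI[of _ F]) auto
  qed
  moreover obtain k where "(2 - gr) ^ k < \<epsilon>" using real_arch_pow_inv[OF assms, of "2 - gr"] gr_bounds by auto
  ultimately obtain F G :: int where FG: "0 < F" "0 \<le> G" "(2 - gr) ^ k = of_int F - of_int G * (gr + 1)" by metis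
  show thesis
  proof (rule that[OF FG(1,2), of "(gr + 1) ^ k"])
    show "(of_int F - of_int G * (gr + 1)) * (gr + 1) ^ k = 1"
      unfolding FG(3)[symmetric] power_mult_distrib[symmetric] inv by simp
  qed (use gr_bounds \<open>(2 - gr) ^ k < \<epsilon>\<close> in \<open>simp_all flip: FG(3)\<close>)
qed

text \<open>
  Modulo \<open>x\<close> and \<open>y\<close> the number \<open>d Q u\<close> vanishes, hence so does \<open>Q\<^sup>2\<close>, as \<open>d\<close> divides \<open>Q\<close> and \<open>u\<close> is a
  unit. But modulo \<open>x\<close> the unit \<open>1 - g\<close> is a multiple of \<open>Q\<close>, so its square vanishes too.
\<close>

lemma comaximal_if_congruent_to_unit:
  assumes w: "w \<in> Zgr" "y \<in> Zgr" and x: "x = (1 - gr) + of_int Q * w"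
    and diff: "x - y = of_int d * of_int Q * u" "u * u' = 1" "u' \<in> Zgr" "Q = d * c"
  shows "comaximal x y"
proof -
  have xZ: "x \<in> Zgr" using w unfolding x by simp
  define s where "s = (gr + 1) * w * w * u' * of_int c"
  have "of_int Q * of_int Q * u = of_int c * (x - y)" using diff(1,4) by simp
  then have Q2: "of_int Q * of_int Q = u' * of_int c * (x - y)" using diff(2) by algebra
  have "(gr + 1) * ((1 - gr) * (1 - gr)) = 1" using gr_square by algebra
  moreover have "(1 - gr) * (1 - gr) = x * (x - 2 * of_int Q * w) + of_int Q * of_int Q * (w * w)"
    unfolding x by (simp add: algebra_simps)
  ultimately have "(gr + 1) * (x * (x - 2 * of_int Q * w) + u' * of_int c * (x - y) * (w * w)) = 1"
    unfolding Q2 by simp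
  then have "((gr + 1) * (x - 2 * of_int Q * w) + s) * x + (- s) * y = 1" unfolding s_def by (simp add: algebra_simps)
  moreover have "(gr + 1) * (x - 2 * of_int Q * w) + s \<in> Zgr" "- s \<in> Zgr"
    using w xZ diff(3) by (simp_all add: s_def)
  ultimately show ?thesis unfolding comaximal_def by blast
qed

text \<open>
  The heights are to be \<open>\<beta>\<^sub>i = 1 - g + Q (w\<^sub>0 g\<^sup>2 + i u)\<close> with \<open>Q = K!\<close> and a small unit \<open>u = F - G g\<^sup>2\<close>. In
  the basis \<open>1\<close>, \<open>g\<^sup>2\<close> the coordinates of \<open>\<beta>\<^sub>i\<close> are \<open>m\<^sub>i + 1\<close> and \<open>M\<^sub>i = Q w\<^sub>0 - 1 - i Q G\<close>, where
  \<open>m\<^sub>i = 1 + i Q F\<close>. What remains is to find \<open>w\<^sub>0\<close> such that \<open>m\<^sub>i\<close> divides \<open>M\<^sub>i\<close>. With \<open>\<rho> = Q F\<close> and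
  \<open>\<sigma> = Q G\<close> one has \<open>\<rho> M\<^sub>i = W - \<sigma> m\<^sub>i\<close> for a number \<open>W\<close> independent of \<open>i\<close>, and \<open>m\<^sub>i\<close> is coprime to \<open>\<rho>\<close>. So it
  suffices that \<open>W\<close> is a common multiple of the \<open>m\<^sub>i\<close>; the relation between \<open>W\<close> and \<open>w\<^sub>0\<close> prescribes its
  residue modulo \<open>\<rho> Q\<close>, which is coprime to all \<open>m\<^sub>i\<close>.
\<close>

lemma close_comaximal_heights:
  fixes K :: nat
  obtains m n :: "nat \<Rightarrow> int" 
  where "\<And>i. i < K \<Longrightarrow> 0 \<le> m i" "\<And>i. i < K \<Longrightarrow> 40 * (m i + 1) \<le> m i * n i"
    "\<And>i j. i < K \<Longrightarrow> j < K \<Longrightarrow> i \<noteq> j \<Longrightarrow> comaximal (golden_int (m i + 1) (m i * n i)) (golden_int (m j + 1) (m j * n j))"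
    "\<And>i j. i < K \<Longrightarrow> j < K \<Longrightarrow> i \<noteq> j \<Longrightarrow> golden_int (m i + 1) (m i * n i) \<noteq> golden_int (m j + 1) (m j * n j)"
    "\<And>i. i < K \<Longrightarrow> \<bar>golden_int (m i + 1) (m i * n i) - golden_int (m 0 + 1) (m 0 * n 0)\<bar> \<le> 1/4"
proof -
  define Q :: int where "Q = fact K"
  have Q: "1 \<le> Q" unfolding Q_def by (rule fact_ge_1)
  have "0 < 1 / (4 * (1 + of_nat K) * of_int Q :: real)" using Q by (simp add: add_pos_nonneg)
  then obtain F G :: int and u' where FG: "0 < F" "0 \<le> G" and u': "u' \<in> Zgr" and
    u: "0 < of_int F - of_int G * (gr + 1)" "of_int F - of_int G * (gr + 1) < 1 / (4 * (1 + of_nat K) * of_int Q)"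
    "(of_int F - of_int G * (gr + 1)) * u' = 1"
    by (rule small_unit)
  define u where "u = of_int F - of_int G * (gr + 1)"
  define \<rho> where "\<rho> = Q * F"
  define \<sigma> where "\<sigma> = Q * G"
  have \<rho>\<sigma>: "1 \<le> \<rho>" "0 \<le> \<sigma>" using Q FG mult_mono[of 1 Q 1 F] by (auto simp: \<rho>_def \<sigma>_def)
  define m where "m i = 1 + int i * \<rho>" for i :: nat
  have m: "1 \<le> m i" for i using \<rho>\<sigma> by (simp add: m_def)
  define P where "P = (\<Prod>i<K. m i)"
  have P: "1 \<le> P" unfolding P_def using m by (intro prod_ge_1) auto
  have cop_m: "coprime (m i) \<rho>" for i
  proof -
    have "gcd (m i) \<rho> dvd m i - int i * \<rho>" by (intro dvd_diff dvd_mult) simp_all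
    then show ?thesis by (simp add: m_def coprime_iff_gcd_eq_1)
  qed
  have "coprime P \<rho>" unfolding P_def by (intro prod_coprime_left cop_m)
  moreover have "coprime P Q" using calculation unfolding \<rho>_def by simp
  ultimately have "coprime P (\<rho> * Q)" by simp
  then obtain x y where xy: "x * P + y * (\<rho> * Q) = 1" using bezout_int[of P "\<rho> * Q"] by auto
  define bound where "bound = 1 + int K * \<sigma> + 40 * (2 + int K * \<rho>)"
  have bound: "0 \<le> bound" using \<rho>\<sigma> by (simp add: bound_def)
  \<comment> \<open>The multiple \<open>h\<close> of the common modulus only serves to make the second coordinates large.\<close>
  define h where "h = \<bar>y * (\<sigma> - \<rho>)\<bar> + bound"
  define w0 where "w0 = - y * (\<sigma> - \<rho>) + P * h"
  define W where "W = P * (x * (\<sigma> - \<rho>) + \<rho> * Q * h)"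
  have W: "W = \<sigma> - \<rho> + \<rho> * Q * w0"
  proof -
    have "W = (x * P) * (\<sigma> - \<rho>) + \<rho> * Q * P * h" by (simp add: W_def algebra_simps)
    also have "x * P = 1 - y * (\<rho> * Q)" using xy by simp
    finally show ?thesis by (simp add: w0_def algebra_simps)
  qed
  have "1 * h \<le> P * h" using P bound by (intro mult_right_mono) (auto simp: h_def)
  then have "bound \<le> w0" by (simp add: w0_def h_def)
  moreover have "1 * w0 \<le> Q * w0" using Q calculation bound by (intro mult_right_mono) auto
  ultimately have Qw0: "bound \<le> Q * w0" by simp
  define M where "M i = -1 + Q * w0 - int i * \<sigma>" for i :: nat
  have m_dvd_M: "m i dvd M i" if "i < K" for i
  proof -
    have "m i dvd P" unfolding P_def using that by (intro dvd_prodI) auto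
    then have "m i dvd W - \<sigma> * m i" by (simp add: W_def)
    also have "W - \<sigma> * m i = \<rho> * M i" by (simp add: W M_def m_def algebra_simps)
    finally show ?thesis using cop_m[of i] coprime_dvd_mult_right_iff by blast
  qed
  define n where "n i = M i div m i" for i
  have mn: "m i * n i = M i" if "i < K" for i using m_dvd_M[OF that] by (simp add: n_def)
  define \<beta> where "\<beta> i = golden_int (m i + 1) (M i)" for i
  have \<beta>: "\<beta> i = (1 - gr) + of_int Q * (of_int w0 * (gr + 1) + of_int (int i) * u)" for i
    by (simp add: \<beta>_def golden_int_def m_def M_def u_def \<rho>_def \<sigma>_def algebra_simps)
  have diff: "\<beta> i - \<beta> j = of_int (int i - int j) * of_int Q * u" for i j
    by (simp add: \<beta> algebra_simps)
  have uZ: "u \<in> Zgr" by (simp add: u_def)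
  have u0: "0 < u" "u * u' = 1" using u by (simp_all add: u_def)
  have co: "comaximal (\<beta> i) (\<beta> j)" if ij: "i < K" "j < K" "i \<noteq> j" for i j
  proof -
    have "int i - int j dvd Q"
    proof -
      have "nat \<bar>int i - int j\<bar> dvd fact K" using ij by (intro dvd_fact) auto
      then show ?thesis unfolding Q_def by (metis abs_dvd_iff int_dvd_int_iff nat_0_le abs_ge_zero of_nat_fact)
    qed
    then obtain c where "Q = (int i - int j) * c" by (elim dvdE)
    then show ?thesis
      using u0(2) u' uZ by (intro comaximal_if_congruent_to_unit[OF _ _ \<beta> diff]) (auto simp: \<beta>_def)
  qed
  have ne: "\<beta> i \<noteq> \<beta> j" if ij: "i \<noteq> j" for i j
    using diff[of i j] ij Q u0(1) by auto
  have close: "\<bar>\<beta> i - \<beta> 0\<bar> \<le> 1/4" if "i < K" for i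
  proof -
    have "\<bar>\<beta> i - \<beta> 0\<bar> = of_nat i * (of_int Q * u)" unfolding diff using Q u0 by (simp add: abs_mult)
    also have "\<dots> \<le> (1 + of_nat K) * (of_int Q * u)" using that Q u0 by (intro mult_right_mono) auto
    also have "\<dots> \<le> 1/4"
    proof -
      have "0 < 4 * (1 + of_nat K) * (of_int Q :: real)" using Q by (simp add: add_pos_nonneg)
      then have "u * (4 * (1 + of_nat K) * of_int Q) < 1" using u(2) unfolding u_def[symmetric] by (simp only: pos_less_divide_eq)
      then show ?thesis by (simp add: algebra_simps)
    qed
    finally show ?thesis .
  qed
  have big: "40 * (m i + 1) \<le> M i" if "i < K" for i
  proof -
    have "int i * \<sigma> \<le> int K * \<sigma>" "int i * \<rho> \<le> int K * \<rho>" using that \<rho>\<sigma> by (auto intro!: mult_right_mono)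
    then show ?thesis using Qw0 by (simp add: M_def m_def bound_def)
  qed
  show thesis
  proof (rule that[of m n])
    fix i assume i: "i < K"
    then have "0 < K" by simp
    then show "\<bar>golden_int (m i + 1) (m i * n i) - golden_int (m 0 + 1) (m 0 * n 0)\<bar> \<le> 1/4"
      using close[OF i] by (simp add: mn i \<beta>_def)
    show "0 \<le> m i" using m[of i] by simp
    show "40 * (m i + 1) \<le> m i * n i" using big[OF i] mn[OF i] by simp
  next
    fix i j assume ij: "i < K" "j < K" "i \<noteq> j"
    show "comaximal (golden_int (m i + 1) (m i * n i)) (golden_int (m j + 1) (m j * n j))"
      "golden_int (m i + 1) (m i * n i) \<noteq> golden_int (m j + 1) (m j * n j)"
      using co[OF ij] ne[OF ij(3)] ij by (simp_all add: mn \<beta>_def)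
  qed
qed

section \<open>Bunching\<close>

text \<open>
  The linear maps applied to \<open>(g - 1, 0)\<close> are, in this order, shears by \<open>m\<close> (vertical), \<open>n\<close> (horizontal),
  1 (vertical) and \<open>k\<close> (horizontal).
\<close>

lemma saddle_period_family:
  fixes m n k :: int
  shows "Complex (gr - 1 + of_int (m * n) * gr + of_int k * gr * golden_int (m + 1) (m * n)) (golden_int (m + 1) (m * n)) \<in> saddle_periods golden_L"
proof -
  have g: "gr * (gr - 1) = 1" using gr_square by algebra
  have "flat_saddle (shear k (mirror (shear 1 (mirror (shear n (mirror (shear m (mirror (Complex (gr - 1) 0)))))))))"
    by (intro flat_saddle_shear flat_saddle_mirror flat_saddle_base)
  also have "shear m (mirror (Complex (gr - 1) 0)) = Complex (of_int m) (gr - 1)"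
    using g by (simp add: complex_eq_iff mult.assoc)
  also have "shear n (mirror (Complex (of_int m) (gr - 1))) = Complex (gr - 1 + of_int (m * n) * gr) (of_int m)"
    by (simp add: complex_eq_iff)
  also have "shear 1 (mirror (Complex (gr - 1 + of_int (m * n) * gr) (of_int m))) = Complex (golden_int (m + 1) (m * n)) (gr - 1 + of_int (m * n) * gr)"
  proof -
    have "of_int m + gr * (gr - 1 + of_int (m * n) * gr) = golden_int (m + 1) (m * n)"
      unfolding golden_int_def of_int_add of_int_mult of_int_1 using gr_square by algebra
    then show ?thesis by (simp add: complex_eq_iff)
  qed
  also have "shear k (mirror (Complex (golden_int (m + 1) (m * n)) (gr - 1 + of_int (m * n) * gr))) =
      Complex (gr - 1 + of_int (m * n) * gr + of_int k * gr * golden_int (m + 1) (m * n)) (golden_int (m + 1) (m * n))"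
    by (simp add: complex_eq_iff)
  finally show ?thesis by (rule saddle_period_if_flat_saddle)
qed

theorem theorem1p3:
  shows "unbounded_bunching golden_L"
  unfolding unbounded_bunching_def
proof (intro allI impI)
  fix K :: nat
  obtain m n :: "nat \<Rightarrow> int" 
    where m: "\<And>i. i < K \<Longrightarrow> 0 \<le> m i" and mn: "\<And>i. i < K \<Longrightarrow> 40 * (m i + 1) \<le> m i * n i"
      and co: "\<And>i j. i < K \<Longrightarrow> j < K \<Longrightarrow> i \<noteq> j \<Longrightarrow> comaximal (golden_int (m i + 1) (m i * n i)) (golden_int (m j + 1) (m j * n j))"
      and ne: "\<And>i j. i < K \<Longrightarrow> j < K \<Longrightarrow> i \<noteq> j \<Longrightarrow> golden_int (m i + 1) (m i * n i) \<noteq> golden_int (m j + 1) (m j * n j)"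
      and close: "\<And>i. i < K \<Longrightarrow> \<bar>golden_int (m i + 1) (m i * n i) - golden_int (m 0 + 1) (m 0 * n 0)\<bar> \<le> 1/4"
    by (rule close_comaximal_heights[of K]) blast
  define b where "b i = golden_int (m i + 1) (m i * n i)" for i
  define a where "a i = gr - 1 + of_int (m i * n i) * gr" for i
  obtain t k where tk: "\<And>i. i < K \<Longrightarrow> \<bar>a i + of_int (k i) * gr * b i - t\<bar> < 1/2"
    using progressions_meet_in_unit_interval[of K "\<lambda>i. m i + 1" "\<lambda>i. m i * n i" a] m mn co by (auto simp: b_def)
  define v where "v i = Complex (a i + of_int (k i) * gr * b i) (b i)" for i
  show "\<exists>c A. A \<subseteq> saddle_periods golden_L \<inter> ball c 1 \<and> finite A \<and> K \<le> card A"
  proof (intro exI conjI)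
    show "v ` {..<K} \<subseteq> saddle_periods golden_L \<inter> ball (Complex t (b 0)) 1"
    proof
      fix z assume "z \<in> v ` {..<K}"
      then obtain i where i: "i < K" "z = v i" by auto
      have "cmod (v i - Complex t (b 0)) \<le> \<bar>a i + of_int (k i) * gr * b i - t\<bar> + \<bar>b i - b 0\<bar>"
        using cmod_le[of "v i - Complex t (b 0)"] by (simp add: v_def)
      also have "\<dots> < 1" using tk[OF i(1)] close[OF i(1)] by (simp add: b_def)
      finally have "v i \<in> ball (Complex t (b 0)) 1" by (simp add: dist_norm norm_minus_commute)
      moreover have "v i \<in> saddle_periods golden_L" unfolding v_def a_def b_def by (rule saddle_period_family)
      ultimately show "z \<in> saddle_periods golden_L \<inter> ball (Complex t (b 0)) 1" using i by simp
    qed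
    have "inj_on v {..<K}" using ne by (intro inj_onI) (auto simp: v_def b_def)
    then show "K \<le> card (v ` {..<K})" by (simp add: card_image)
  qed simp
qed

end
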